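(* Let $a\ge1$ be an integer. The wave function $\vec Z^{[a]}(x,\hbar)$ for monotone $a$-orbifold Hurwitz numbers is given by $$\vec Z^{[a]}(x,\hbar)=1+\sum_{k=1}^\infty \frac{x^{ak}}{k!\,a^k\,\hbar^k}\prod_{j=1}^{ak-1}\frac{1}{1-j\hbar}.$$ Furthermore, it satisfies the differential equation $$\left[\widehat x^{\,a-1}+\prod_{j=0}^{a-1}\bigl(1+\widehat x\,\widehat y+j\hbar\bigr)\,\widehat y\right]\vec Z^{[a]}(x,\hbar)=0,$$ where $\widehat x=x$ (multiplication by $x$) and $\widehat y=-\hbar\frac{\partial}{\partial x}$.
   Context: A sequence of transpositions $\sigma_1,\dots,\sigma_m$, written $\sigma_i=(r_i\ s_i)$ with $r_i<s_i$, is monotone if $s_1\le s_2\le\cdots\le s_m$. For integers $g\ge0$, $n\ge1$ and positive integers $\mu_1,\dots,\mu_n$ with $|\boldsymbol\mu|=\mu_1+\cdots+\mu_n$, the monotone $a$-orbifold Hurwitz number $\vec H^{[a]}_{g,n}(\mu_1,\dots,\mu_n)$ is $\frac1{|\boldsymbol\mu|!}$ times the number of tuples $(\sigma_0,\sigma_1,\dots,\sigma_m)$ of permutations in $S_{|\boldsymbol\mu|}$ such that: $m=2g-2+n+\frac{|\boldsymbol\mu|}{a}$; $\sigma_0$ has cycle type $(a,a,\dots,a)$ and $\sigma_1,\dots,\sigma_m$ is a monotone sequence of transpositions; the cycles of $\sigma_0\sigma_1\cdots\sigma_m$ (fixed points included) are labelled $1,\dots,n$ so that cycle $i$ has length $\mu_i$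 (the labelling is part of the data being counted); and $\sigma_0,\dots,\sigma_m$ generate a transitive subgroup of $S_{|\boldsymbol\mu|}$. In particular the number is $0$ if $a\nmid|\boldsymbol\mu|$. The free energies are $$\vec F^{[a]}_{g,n}(x_1,\dots,x_n)=\sum_{\mu_1,\dots,\mu_n=1}^\infty \vec H^{[a]}_{g,n}(\mu_1,\dots,\mu_n)\prod_{i=1}^n x_i^{\mu_i},$$ and the wave function is $$\vec Z^{[a]}(x,\hbar)=\exp\left[\sum_{g=0}^\infty\sum_{n=1}^\infty\frac{\hbar^{2g-2+n}}{n!}\,\vec F^{[a]}_{g,n}(x,\dots,x)\right],$$ regarded as an element of $\mathbb Q(\!(\hbar)\!)[[x]]$ (formal power series in $x$ with coefficients Laurent series in $\hbar$); $\frac{1}{1-j\hbar}$ is expanded as a geometric series in $\hbar$. Empty products equal $1$. In the operator, the product over $j$ is composed with $\widehat y$, with $\widehat y$ acting first. *)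

theory Defs
  imports
    "HOL-Algebra.Sym_Groups"
    "HOL-Combinatorics.Orbits"
    "HOL-Computational_Algebra.Formal_Laurent_Series"
begin

section \<open>Monotone orbifold Hurwitz numbers\<close>

text \<open>The cycles of a permutation of \<open>{1..d}\<close>, as subsets; a fixed point gives a singleton.\<close>

definition perm_cycles :: "nat \<Rightarrow> (nat \<Rightarrow> nat) \<Rightarrow> nat set set" where
  "perm_cycles d p = orbit p ` {1..d}"

definition cycle_type :: "nat \<Rightarrow> (nat \<Rightarrow> nat) \<Rightarrow> nat multiset" where
  "cycle_type d p = image_mset card (mset_set (perm_cycles d p))"

definition monotone_transpositions :: "nat \<Rightarrow> (nat \<Rightarrow> nat) list \<Rightarrow> bool" where
  "monotone_transpositions d ts \<longleftrightarrow>
     (\<exists>rs. (\<forall>(r, s) \<in> set rs. r \<in> {1..d} \<and> s \<in> {1..d} \<and> r < s) \<and>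
           ts = map (\<lambda>(r, s). Transposition.transpose r s) rs \<and> sorted (map snd rs))"

definition generates_transitive :: "nat \<Rightarrow> (nat \<Rightarrow> nat) set \<Rightarrow> bool" where
  "generates_transitive d P \<longleftrightarrow>
     (\<forall>x \<in> {1..d}. \<forall>y \<in> {1..d}. \<exists>h \<in> generate (sym_group d) P. h x = y)"

text \<open>
  The objects counted, for \<open>d = \<bar>\<mu>\<bar>\<close> and \<open>n = length \<mu>\<close>: triples of the permutation \<open>\<sigma>\<^sub>0\<close>,
  the list \<open>\<sigma>\<^sub>1, \<dots>, \<sigma>\<^sub>m\<close>, and a labelling of the cycles of the product, given as a list that
  enumerates the cycles without repetition. The formula for \<open>m\<close> is an equation between
  rationals, so that no truncation occurs in the division by \<open>a\<close> or in the subtraction.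
  Composing in the opposite order gives the same count: invert the product and replace
  \<open>\<sigma>\<^sub>0\<close> by its inverse.
\<close>

definition hurwitz_tuples ::
  "nat \<Rightarrow> nat \<Rightarrow> nat list \<Rightarrow> ((nat \<Rightarrow> nat) \<times> (nat \<Rightarrow> nat) list \<times> nat set list) set" where
  "hurwitz_tuples a g \<mu> =
     (let d = sum_list \<mu>; n = length \<mu> in
      {(\<sigma>\<^sub>0, ts, Cs).
         \<sigma>\<^sub>0 permutes {1..d} \<and>
         (\<exists>k. cycle_type d \<sigma>\<^sub>0 = replicate_mset k a) \<and>
         (of_nat (length ts) :: rat) = 2 * of_nat g - 2 + of_nat n + of_nat d / of_nat a \<and>
         monotone_transpositions d ts \<and>
         distinct Cs \<and> set Cs = perm_cycles d (\<sigma>\<^sub>0 \<circ> foldr (\<circ>) ts id) \<and>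
         map card Cs = \<mu> \<and>
         generates_transitive d (insert \<sigma>\<^sub>0 (set ts))})"

definition monotone_hurwitz :: "nat \<Rightarrow> nat \<Rightarrow> nat list \<Rightarrow> rat" where
  "monotone_hurwitz a g \<mu> = of_nat (card (hurwitz_tuples a g \<mu>)) / fact (sum_list \<mu>)"

lemma finite_hurwitz_tuples: "finite (hurwitz_tuples a g \<mu>)"
proof -
  define d where "d = sum_list \<mu>"
  define q :: rat where "q = 2 * of_nat g - 2 + of_nat (length \<mu>) + of_nat d / of_nat a"
  define m where "m = (THE l. (of_nat l :: rat) = q)"
  define P where "P = {p. p permutes {1..d}}"
  define T where "T = {ts. set ts \<subseteq> P \<and> length ts = m}"
  define L where "L = {Cs. set Cs \<subseteq> Pow {1..d} \<and> length Cs = length \<mu>}"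
  have fP: "finite P"
    unfolding P_def by (simp add: finite_permutations)
  have fin: "finite (P \<times> T \<times> L)"
    unfolding T_def L_def using fP by (intro finite_cartesian_product finite_lists_length_eq) auto
  have m_eq: "l = m" if "(of_nat l :: rat) = q" for l
    unfolding m_def using that by (intro the_equality[symmetric]) auto
  have trans_P: "set ts \<subseteq> P" if "monotone_transpositions d ts" for ts
    using that unfolding monotone_transpositions_def P_def
    by (fastforce intro: permutes_swap_id)
  have comp_P: "foldr (\<circ>) ts id permutes {1..d}" if "set ts \<subseteq> P" for ts
    using that by (induction ts) (auto simp: P_def permutes_id intro: permutes_compose)
  have cyc: "perm_cycles d p \<subseteq> Pow {1..d}" if "p permutes {1..d}" for p
    unfolding perm_cycles_def using permutes_orbit_subset[OF that] by blast
  have "hurwitz_tuples a g \<mu> \<subseteq> P \<times> T \<times> L"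
  proof
    fix t assume "t \<in> hurwitz_tuples a g \<mu>"
    then obtain s ts Cs where t: "t = (s, ts, Cs)" and s: "s permutes {1..d}"
      and l: "(of_nat (length ts) :: rat) = q" and mt: "monotone_transpositions d ts"
      and Cs: "set Cs = perm_cycles d (s \<circ> foldr (\<circ>) ts id)" and mc: "map card Cs = \<mu>"
      unfolding hurwitz_tuples_def Let_def d_def q_def by auto
    have "(s \<circ> foldr (\<circ>) ts id) permutes {1..d}"
      using comp_P[OF trans_P[OF mt]] s by (rule permutes_compose)
    then have "set Cs \<subseteq> Pow {1..d}"
      using cyc Cs by simp
    moreover have "length Cs = length \<mu>"
      using mc by auto
    ultimately show "t \<in> P \<times> T \<times> L"
      using t s trans_P[OF mt] m_eq[OF l] unfolding P_def T_def L_def by auto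
  qed
  then show ?thesis
    using fin finite_subset by blast
qed


section \<open>Free energies and wave function\<close>

text \<open>
  A formal power series in \<open>n\<close> variables is represented by its coefficients, indexed by exponent
  lists of length \<open>n\<close>; the number of variables is thus the length of the argument.
\<close>

definition free_energy :: "nat \<Rightarrow> nat \<Rightarrow> nat list \<Rightarrow> rat" where
  "free_energy a g e = (if \<forall>i \<in> set e. i \<ge> 1 then monotone_hurwitz a g e else 0)"

text \<open>The series \<open>F\<^sub>g\<^sub>,\<^sub>n(x, \<dots>, x)\<close>: monomials of the same total degree are collected.\<close>

definition free_energy_diag :: "nat \<Rightarrow> nat \<Rightarrow> nat \<Rightarrow> rat fps" where
  "free_energy_diag a g n =
     Abs_fps (\<lambda>d. \<Sum>e | length e = n \<and> sum_list e = d. free_energy a g e)"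

text \<open>
  The double sum inside the exponential, taken coefficientwise: the coefficient of \<open>x\<^sup>d \<hbar>\<^sup>k\<close>
  is a sum over the finitely many \<open>(g, n)\<close> with \<open>2g - 2 + n = k\<close>, and it vanishes
  for \<open>k < - 1\<close>.
\<close>

definition wave_exponent :: "nat \<Rightarrow> rat fls fps" where
  "wave_exponent a =
     Abs_fps (\<lambda>d. Abs_fls (\<lambda>k.
       \<Sum>(g, n) | n \<ge> 1 \<and> 2 * int g - 2 + int n = k. fps_nth (free_energy_diag a g n) d / fact n))"

lemma finite_genus_index: "finite {(g, n). n \<ge> 1 \<and> 2 * int g - 2 + int n = k}"
proof (rule finite_subset)
  show "{(g, n). n \<ge> 1 \<and> 2 * int g - 2 + int n = k} \<subseteq> {..nat (k + 2)} \<times> {..nat (k + 2)}"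
    by auto
qed simp

lemma finite_exponents: "finite {e :: nat list. length e = n \<and> sum_list e = d}"
proof (rule finite_subset)
  show "{e. length e = n \<and> sum_list e = d} \<subseteq> {e. set e \<subseteq> {..d} \<and> length e = n}"
    using member_le_sum_list by fastforce
  show "finite {e. set e \<subseteq> {..d} \<and> length e = n}"
    by (rule finite_lists_length_eq) simp
qed

lemma wave_exponent_nth_nth:
  "fls_nth (fps_nth (wave_exponent a) d) k =
     (\<Sum>(g, n) | n \<ge> 1 \<and> 2 * int g - 2 + int n = k. fps_nth (free_energy_diag a g n) d / fact n)"
proof -
  have zero: "(\<Sum>(g, n) | n \<ge> 1 \<and> 2 * int g - 2 + int n = j.
      fps_nth (free_energy_diag a g n) d / fact n) = 0" if "j < -1" for j
    using that by (intro sum.neutral) auto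
  show ?thesis
    unfolding wave_exponent_def fps_nth_Abs_fps
    by (subst nth_Abs_fls_lower_bound[of "-1"]) (use zero in blast)+
qed

lemma wave_exponent_nth_0: "fps_nth (wave_exponent a) 0 = 0"
proof (rule fls_eqI)
  fix k
  have "fps_nth (free_energy_diag a g n) 0 = 0" if "n \<ge> 1" for g n
    unfolding free_energy_diag_def fps_nth_Abs_fps
  proof (rule sum.neutral, safe)
    fix e :: "nat list" assume "n = length e" "sum_list e = 0"
    with that show "free_energy a g e = 0"
      by (cases e) (auto simp: free_energy_def)
  qed
  then show "fls_nth (fps_nth (wave_exponent a) 0) k = fls_nth 0 k"
    unfolding wave_exponent_nth_nth by (auto intro!: sum.neutral)
qed

definition wave_function :: "nat \<Rightarrow> rat fls fps" where
  "wave_function a = fps_exp 1 oo wave_exponent a"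


section \<open>Operators\<close>

definition hbar :: "rat fls" where
  "hbar = fls_X"

definition x_hat :: "rat fls fps \<Rightarrow> rat fls fps" where
  "x_hat f = fps_X * f"

definition y_hat :: "rat fls fps \<Rightarrow> rat fls fps" where
  "y_hat f = - (fps_const hbar * fps_deriv f)"

definition curve_factor :: "nat \<Rightarrow> rat fls fps \<Rightarrow> rat fls fps" where
  "curve_factor j f = f + x_hat (y_hat f) + fps_const (of_nat j * hbar) * f"

text \<open>The factor with index \<open>0\<close> is leftmost, that is, it acts last.\<close>

definition curve_operator :: "nat \<Rightarrow> rat fls fps \<Rightarrow> rat fls fps" where
  "curve_operator a f =
     (x_hat ^^ (a - 1)) f + foldr (\<circ>) (map curve_factor [0..<a]) id (y_hat f)"

end

(*
  Let D(B) be the generating function, by number m of transpositions, of all pairs of a permutation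
  of B with every cycle of length a and a monotone list of transpositions of B, transitive or not,
  and let C(B) count the transitive pairs.  A pair decomposes along its orbits, and merging the
  monotone lists of disjoint sets is unambiguous because the larger entries differ, so for x in B
      D(B) = sum over A with x in A of C(A) D(B - A).
  After division by factorials this says Z' = Z W', which makes Z = sum D({1..d}) x^d / d! (shifted in
  hbar by d/a) the exponential of the generating function W of the transitive counts.  The list
  factor of D is the complete homogeneous series 1 / prod_{j<d} (1 - j hbar), built up by adding the
  largest element last; the number of permutations comes from the same recursion at m = 0.
  That the sum over (g, n) in the exponent exhausts all transitive pairs is the Riemann-Hurwitz
  formula: 2g - 2 + n = m - d/a has a solution g >= 0.  The differential equation is the two-term
  recursion satisfied by the coefficients.
*)
theory Submission
  imports Defs "HOL-Combinatorics.Multiset_Permutations"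
begin

section \<open>Decomposition into connected configurations\<close>

text \<open>Transpositions are kept as ordered pairs, since monotonicity is a condition on the
  larger entries, and splitting or merging a list has to read them; a transposition determines its
  pair, so nothing is lost. The sets \<open>B\<close> are arbitrary finite sets of naturals, because
  the blocks of a decomposition need not be intervals. That the series depend only on
  \<open>card B\<close> is not proved by relabelling: for \<open>config_gf\<close> it is read off
  the closed form, for \<open>connected_gf\<close> it follows by solving the recursion for its top
  term. The set \<open>S\<close> of allowed cycle lengths is a parameter so that one recursion
  serves twice: with \<open>S = UNIV\<close> and empty lists it counts full cycles, and this number
  enters for the only block size that survives when \<open>S = {a}\<close>. Transitivity is
  expressed by invariant subsets instead of a generated group, which makes it local to a block. The
  labellings of the cycles of the product contribute \<open>n!\<close>, which cancels the
  \<open>1 / n!\<close> in the exponent, and summing over all length lists removes the condition on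
  the cycle type; what remains of the product is its number of cycles, which determines the
  genus.\<close>

definition monotone_pairs :: "nat set \<Rightarrow> (nat \<times> nat) list set" where
  "monotone_pairs B = {rs. (\<forall>(r, s) \<in> set rs. r \<in> B \<and> s \<in> B \<and> r < s) \<and> sorted (map snd rs)}"

text \<open>For \<open>r \<noteq> s\<close> the condition on a pair says exactly that the
  transposition maps \<open>A\<close> into itself. For \<open>p\<close> the same one-sided condition
  is used; on a finite set injectivity turns it into an equivalence.\<close>

definition invariant :: "(nat \<Rightarrow> nat) \<Rightarrow> (nat \<times> nat) list \<Rightarrow> nat set \<Rightarrow> bool" where
  "invariant p rs A \<longleftrightarrow> (\<forall>x\<in>A. p x \<in> A) \<and> (\<forall>(r, s) \<in> set rs. r \<in> A \<longleftrightarrow> s \<in> A)"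

text \<open>The empty set is connected in this sense, whereas the exponent of the wave function has
  no constant term. Comparisons between the two are therefore made for
  \<open>d \<ge> 1\<close>.\<close>

definition connected_on :: "nat set \<Rightarrow> (nat \<Rightarrow> nat) \<Rightarrow> (nat \<times> nat) list \<Rightarrow> bool" where
  "connected_on B p rs \<longleftrightarrow> (\<forall>A\<subseteq>B. A \<noteq> {} \<longrightarrow> invariant p rs A \<longrightarrow> A = B)"

definition configs :: "nat set \<Rightarrow> nat set \<Rightarrow> nat \<Rightarrow> ((nat \<Rightarrow> nat) \<times> (nat \<times> nat) list) set" where
  "configs S B m = {(p, rs). p permutes B \<and> (\<forall>x\<in>B. card (orbit p x) \<in> S) \<and>
     rs \<in> monotone_pairs B \<and> length rs = m}"

definition connected_configs ::
    "nat set \<Rightarrow> nat set \<Rightarrow> nat \<Rightarrow> ((nat \<Rightarrow> nat) \<times> (nat \<times> nat) list) set" where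
  "connected_configs S B m = {(p, rs) \<in> configs S B m. connected_on B p rs}"

lemma permutes_permutation: "p permutes B \<Longrightarrow> finite B \<Longrightarrow> permutation p"
  by (auto simp: permutation_permutes)

lemma permutes_self_in_orbit: "p permutes B \<Longrightarrow> finite B \<Longrightarrow> x \<in> orbit p x"
  by (simp add: permutation_self_in_orbit permutes_permutation)

lemma finite_monotone_pairs:
  assumes "finite B"
  shows "finite {rs \<in> monotone_pairs B. length rs = m}"
proof (rule finite_subset)
  show "{rs \<in> monotone_pairs B. length rs = m} \<subseteq> {rs. set rs \<subseteq> B \<times> B \<and> length rs = m}"
    by (auto simp: monotone_pairs_def)
  show "finite {rs. set rs \<subseteq> B \<times> B \<and> length rs = m}"
    using assms by (intro finite_lists_length_eq) auto
qed

lemma finite_configs: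
  assumes "finite B"
  shows "finite (configs S B m)"
proof (rule finite_subset)
  show "configs S B m \<subseteq> {p. p permutes B} \<times> {rs \<in> monotone_pairs B. length rs = m}"
    by (auto simp: configs_def)
  show "finite ({p. p permutes B} \<times> {rs \<in> monotone_pairs B. length rs = m})"
    using assms finite_permutations finite_monotone_pairs by blast
qed

lemma finite_connected_configs: "finite B \<Longrightarrow> finite (connected_configs S B m)"
  using finite_configs[of B S m] by (rule rev_finite_subset) (auto simp: connected_configs_def)

section \<open>Invariant sets, restriction and gluing\<close>

lemma invariant_Int: "invariant p rs A \<Longrightarrow> invariant p rs A' \<Longrightarrow> invariant p rs (A \<inter> A')"
  by (auto simp: invariant_def)

lemma permutes_image_eq_of_stable:
  assumes "p permutes B" "finite A" "\<forall>x\<in>A. p x \<in> A"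
  shows "p ` A = A"
  using assms by (metis endo_inj_surj image_subsetI inj_on_subset permutes_inj subset_UNIV)

lemma permutes_stable_iff:
  assumes "p permutes B" "finite A" "\<forall>x\<in>A. p x \<in> A"
  shows "p x \<in> A \<longleftrightarrow> x \<in> A"
  using permutes_image_eq_of_stable[OF assms] permutes_inj[OF assms(1)]
  by (metis inj_image_mem_iff)

text \<open>Finiteness enters here: a stable \<open>A'\<close> is mapped onto itself, so no point
  outside can be sent into it.\<close>

lemma invariant_Diff:
  assumes "p permutes B" "finite A" "invariant p rs A'" "invariant p rs A" "A' \<subseteq> A"
  shows "invariant p rs (A - A')"
proof -
  have "p x \<in> A' \<longleftrightarrow> x \<in> A'" for x
    using permutes_stable_iff[OF assms(1), of A' x] assms finite_subset
    by (auto simp: invariant_def)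
  then show ?thesis
    using assms by (fastforce simp: invariant_def)
qed

lemma permutes_glue:
  assumes "finite A" "finite C" "A \<inter> C = {}" "p permutes A" "q permutes C"
  shows "(\<lambda>x. if x \<in> A then p x else q x) permutes (A \<union> C)"
proof (rule bij_imp_permutes)
  have "bij_betw (\<lambda>x. if x \<in> A then p x else q x) A A"
    using permutes_imp_bij[OF assms(4)] by (rule bij_betw_cong[THEN iffD1, rotated]) auto
  moreover have "bij_betw (\<lambda>x. if x \<in> A then p x else q x) C C"
    using permutes_imp_bij[OF assms(5)] by (rule bij_betw_cong[THEN iffD1, rotated])
      (use assms(3) in auto)
  ultimately show "bij_betw (\<lambda>x. if x \<in> A then p x else q x) (A \<union> C) (A \<union> C)"
    using assms(3) by (rule bij_betw_combine)
qed (use assms in \<open>auto simp: permutes_def\<close>)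

lemma permutes_restrict_stable:
  assumes "p permutes B" "finite A" "\<forall>x\<in>A. p x \<in> A"
  shows "perm_restrict p A permutes A"
proof (rule bij_imp_permutes)
  have "bij_betw p A A"
    using permutes_image_eq_of_stable[OF assms] permutes_inj_on[OF assms(1)]
    by (simp add: bij_betw_def)
  then show "bij_betw (perm_restrict p A) A A"
    by (rule bij_betw_cong[THEN iffD1, rotated]) (simp add: perm_restrict_def)
qed (simp add: perm_restrict_def)

lemma orbit_agree:
  assumes "x \<in> A" "\<forall>y\<in>A. f y \<in> A" "\<And>y. y \<in> A \<Longrightarrow> f y = g y"
  shows "orbit f x = orbit g x"
  using assms by (intro orbit_cong0[where A = A]) auto

text \<open>The list is filtered by the larger entry alone. For an invariant \<open>A\<close> the
  smaller entry lies on the same side, and a condition on the sorting key can be undone by a stable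
  sort.\<close>

definition restrict_config ::
    "nat set \<Rightarrow> (nat \<Rightarrow> nat) \<times> (nat \<times> nat) list \<Rightarrow> (nat \<Rightarrow> nat) \<times> (nat \<times> nat) list" where
  "restrict_config A c = (perm_restrict (fst c) A, filter (\<lambda>(r, s). s \<in> A) (snd c))"

text \<open>Since \<open>sort_key\<close> is stable, pairs with the same larger entry keep their
  order; for disjoint sets all of them come from one of the two lists, so the merge is
  unambiguous.\<close>

definition glue_configs ::
    "nat set \<Rightarrow> ((nat \<Rightarrow> nat) \<times> (nat \<times> nat) list) \<times> ((nat \<Rightarrow> nat) \<times> (nat \<times> nat) list) \<Rightarrow>
       (nat \<Rightarrow> nat) \<times> (nat \<times> nat) list" where
  "glue_configs A cc = ((\<lambda>x. if x \<in> A then fst (fst cc) x else fst (snd cc) x),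
     sort_key snd (snd (fst cc) @ snd (snd cc)))"

lemma restrict_config_in:
  assumes "(p, rs) \<in> configs S B m" "finite B" "A \<subseteq> B" "invariant p rs A"
  shows "restrict_config A (p, rs) \<in> configs S A (length (filter (\<lambda>(r, s). s \<in> A) rs))"
proof -
  have p: "p permutes B" and st: "\<forall>x\<in>A. p x \<in> A"
    using assms by (auto simp: configs_def invariant_def)
  have fA: "finite A"
    using assms finite_subset by blast
  have "orbit (perm_restrict p A) x = orbit p x" if "x \<in> A" for x
    by (rule orbit_agree[where A = A]) (use that st in \<open>auto simp: perm_restrict_def\<close>)
  moreover have "filter (\<lambda>(r, s). s \<in> A) rs \<in> monotone_pairs A"
    using assms by (fastforce simp: configs_def monotone_pairs_def invariant_def intro: sorted_filter)
  ultimately show ?thesis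
    using permutes_restrict_stable[OF p fA st] assms(1,3)
    by (auto simp: configs_def restrict_config_def)
qed

lemma glue_configs_in:
  assumes "c \<in> configs S A i" "c' \<in> configs S C j" "finite A" "finite C" "A \<inter> C = {}"
  shows "glue_configs A (c, c') \<in> configs S (A \<union> C) (i + j)"
proof -
  obtain p rs q ts where c: "c = (p, rs)" "c' = (q, ts)"
    by fastforce
  define h where "h = (\<lambda>x. if x \<in> A then p x else q x)"
  have p: "p permutes A" and q: "q permutes C"
    using assms c by (auto simp: configs_def)
  have "orbit h x = orbit p x" if "x \<in> A" for x
    by (rule orbit_agree[where A = A])
      (use that p in \<open>auto simp: h_def permutes_in_image\<close>)
  moreover have "orbit h x = orbit q x" if "x \<in> C" for x
    by (rule orbit_agree[where A = C])
      (use that q assms(5) in \<open>auto simp: h_def permutes_in_image\<close>)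
  moreover have "h permutes (A \<union> C)"
    using permutes_glue[OF assms(3-5) p q] by (simp add: h_def)
  moreover have "glue_configs A (c, c') = (h, sort_key snd (rs @ ts))"
    by (simp add: c glue_configs_def h_def cong: if_cong)
  ultimately show ?thesis
    using assms(1,2) by (auto simp: c configs_def monotone_pairs_def)
qed

lemma glue_invariant:
  assumes "c \<in> configs S A i" "c' \<in> configs S C j" "A \<inter> C = {}" "glue_configs A (c, c') = (p, rs)"
  shows "invariant p rs A"
  using assms
  by (fastforce simp: invariant_def glue_configs_def configs_def monotone_pairs_def permutes_in_image)

text \<open>\<open>P\<close> depends on the key only (through \<open>Q\<close>), so elements with
  equal keys are all kept together by one of the two filters, in their original order. Sortedness
  and the order within each key class determine the result of a stable sort.\<close>

lemma sort_filter_append: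
  assumes "sorted (map f xs)" "\<And>x. x \<in> set xs \<Longrightarrow> P x = Q (f x)"
  shows "sort_key f (filter P xs @ filter (\<lambda>x. \<not> P x) xs) = xs"
proof (rule properties_for_sort_key)
  fix k assume k: "k \<in> set xs"
  show "filter (\<lambda>x. f k = f x) xs = filter (\<lambda>x. f k = f x) (filter P xs @ filter (\<lambda>x. \<not> P x) xs)"
  proof (cases "Q (f k)")
    case True
    then have "filter (\<lambda>x. P x \<and> f k = f x) xs = filter (\<lambda>x. f k = f x) xs"
      "filter (\<lambda>x. \<not> P x \<and> f k = f x) xs = []"
      using assms(2) by (auto intro!: filter_cong simp: filter_empty_conv)
    then show ?thesis by (simp add: conj_commute)
  next
    case False
    then have "filter (\<lambda>x. \<not> P x \<and> f k = f x) xs = filter (\<lambda>x. f k = f x) xs"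
      "filter (\<lambda>x. P x \<and> f k = f x) xs = []"
      using assms(2) by (auto intro!: filter_cong simp: filter_empty_conv)
    then show ?thesis by (simp add: conj_commute)
  qed
qed (use assms in auto)

text \<open>Invariance of a subset of \<open>A\<close> involves only the values of \<open>p\<close>
  on \<open>A\<close> and the pairs inside \<open>A\<close>: a pair outside \<open>A\<close> has
  neither entry in the subset.\<close>

lemma connected_on_restrict:
  assumes "invariant p rs A"
  shows "connected_on A (perm_restrict p A) (filter (\<lambda>(r, s). s \<in> A) rs) \<longleftrightarrow> connected_on A p rs"
proof -
  have "invariant (perm_restrict p A) (filter (\<lambda>(r, s). s \<in> A) rs) A' = invariant p rs A'"
    if "A' \<subseteq> A" for A'
    using assms that by (fastforce simp: invariant_def perm_restrict_def)
  then show ?thesis by (simp add: connected_on_def)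
qed

lemma glue_restrict:
  assumes "(p, rs) \<in> configs S B m" "A \<subseteq> B" "invariant p rs A"
  shows "glue_configs A (restrict_config A (p, rs), restrict_config (B - A) (p, rs)) = (p, rs)"
proof -
  have rs: "sorted (map snd rs)" "\<And>r s. (r, s) \<in> set rs \<Longrightarrow> s \<in> B"
    and p: "p permutes B"
    using assms(1) by (auto simp: configs_def monotone_pairs_def)
  \<comment> \<open>All larger entries lie in \<open>B\<close>, so on this list membership in
    \<open>B - A\<close> is the negation of membership in \<open>A\<close>.\<close>
  have "filter (\<lambda>(r, s). s \<in> B - A) rs = filter (\<lambda>x. \<not> (case x of (r, s) \<Rightarrow> s \<in> A)) rs"
    by (rule filter_cong) (use rs in auto)
  moreover have "sort_key snd (filter (\<lambda>(r, s). s \<in> A) rs @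
      filter (\<lambda>x. \<not> (case x of (r, s) \<Rightarrow> s \<in> A)) rs) = rs"
    by (rule sort_filter_append[where Q = "\<lambda>s. s \<in> A"]) (use rs in auto)
  moreover have "(\<lambda>x. if x \<in> A then perm_restrict p A x else perm_restrict p (B - A) x) = p"
    using p by (auto simp: perm_restrict_def fun_eq_iff permutes_def)
  ultimately show ?thesis
    by (simp add: glue_configs_def restrict_config_def del: Diff_iff cong: if_cong)
qed

lemma restrict_glue:
  assumes "c \<in> configs S A i" "c' \<in> configs S C j" "A \<inter> C = {}"
  shows "restrict_config A (glue_configs A (c, c')) = c"
    and "restrict_config C (glue_configs A (c, c')) = c'"
proof -
  obtain p rs q ts where c: "c = (p, rs)" "c' = (q, ts)"
    by fastforce
  have rs: "\<And>r s. (r, s) \<in> set rs \<Longrightarrow> s \<in> A" "sorted (map snd rs)" "p permutes A"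
    and ts: "\<And>r s. (r, s) \<in> set ts \<Longrightarrow> s \<in> C" "sorted (map snd ts)" "q permutes C"
    using assms by (auto simp: c configs_def monotone_pairs_def)
  have "filter (\<lambda>(r, s). s \<in> A) rs = rs" "filter (\<lambda>(r, s). s \<in> A) ts = []"
    using rs(1) ts(1) assms(3) by (fastforce simp: filter_id_conv filter_empty_conv)+
  moreover have "filter (\<lambda>(r, s). s \<in> C) ts = ts" "filter (\<lambda>(r, s). s \<in> C) rs = []"
    using rs(1) ts(1) assms(3) by (fastforce simp: filter_id_conv filter_empty_conv)+
  ultimately show "restrict_config A (glue_configs A (c, c')) = c"
    "restrict_config C (glue_configs A (c, c')) = c'"
    using rs ts assms(3)
    by (auto simp: restrict_config_def glue_configs_def c filter_sort sort_key_id_if_sorted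
        perm_restrict_def permutes_def fun_eq_iff)
qed

text \<open>Restriction to \<open>A\<close> and to \<open>B - A\<close> is a bijection with inverse
  gluing; connectedness is asked only of the part on \<open>A\<close>. The index \<open>i\<close> is
  the number of transpositions inside \<open>A\<close>, so the product sets for different
  \<open>i\<close> are disjoint.\<close>

lemma card_configs_block:
  assumes "finite B" "A \<subseteq> B"
  shows "card {(p, rs) \<in> configs S B m. invariant p rs A \<and> connected_on A p rs} =
    (\<Sum>i\<le>m. card (connected_configs S A i) * card (configs S (B - A) (m - i)))"
proof -
  let ?L = "{(p, rs) \<in> configs S B m. invariant p rs A \<and> connected_on A p rs}"
  let ?T = "\<lambda>i. connected_configs S A i \<times> configs S (B - A) (m - i)"
  have fA: "finite A" and fB: "finite (B - A)" and un: "A \<union> (B - A) = B"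
    using assms finite_subset by auto
  have "bij_betw (\<lambda>c. (restrict_config A c, restrict_config (B - A) c)) ?L (\<Union>i\<le>m. ?T i)"
  proof (rule bij_betw_byWitness[where f' = "glue_configs A"])
    show "\<forall>c\<in>?L. glue_configs A (restrict_config A c, restrict_config (B - A) c) = c"
      using glue_restrict assms(2) by auto
    show "\<forall>c'\<in>\<Union>i\<le>m. ?T i. (restrict_config A (glue_configs A c'),
        restrict_config (B - A) (glue_configs A c')) = c'"
      using restrict_glue[where C = "B - A" and A = A]
      by (auto simp: connected_configs_def)
    show "(\<lambda>c. (restrict_config A c, restrict_config (B - A) c)) ` ?L \<subseteq> (\<Union>i\<le>m. ?T i)"
    proof (rule image_subsetI)
      fix pr assume "pr \<in> ?L"
      then obtain p rs where pr: "pr = (p, rs)"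
        and c: "(p, rs) \<in> configs S B m" "invariant p rs A" "connected_on A p rs"
        by auto
      define i where "i = length (filter (\<lambda>(r, s). s \<in> A) rs)"
      have p: "p permutes B" and "invariant p rs B" and m: "length rs = m"
        and sB: "\<And>r s. (r, s) \<in> set rs \<Longrightarrow> s \<in> B"
        using c by (auto simp: configs_def invariant_def monotone_pairs_def permutes_in_image)
      then have inv: "invariant p rs (B - A)"
        using invariant_Diff assms c by blast
      have "filter (\<lambda>(r, s). s \<in> B - A) rs = filter (\<lambda>x. \<not> (case x of (r, s) \<Rightarrow> s \<in> A)) rs"
        by (rule filter_cong) (use sB in auto)
      then have l: "length (filter (\<lambda>(r, s). s \<in> B - A) rs) = m - i"
        using sum_length_filter_compl[of "\<lambda>(r, s). s \<in> A" rs] by (simp add: m i_def)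
      have "i \<le> m"
        by (simp add: i_def flip: m)
      moreover have "restrict_config A (p, rs) \<in> connected_configs S A i"
        using restrict_config_in[OF c(1) assms c(2)] connected_on_restrict[OF c(2)] c(3)
        by (auto simp: connected_configs_def restrict_config_def i_def)
      moreover have "restrict_config (B - A) (p, rs) \<in> configs S (B - A) (m - i)"
        using restrict_config_in[OF c(1) assms(1) _ inv] l by auto
      ultimately show "(restrict_config A pr, restrict_config (B - A) pr) \<in> (\<Union>i\<le>m. ?T i)"
        unfolding pr by blast
    qed
    show "glue_configs A ` (\<Union>i\<le>m. ?T i) \<subseteq> ?L"
    proof (rule image_subsetI)
      fix cc assume "cc \<in> (\<Union>i\<le>m. ?T i)"
      then obtain i c c' where i: "i \<le> m" and cc: "cc = (c, c')" "c \<in> connected_configs S A i"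
        "c' \<in> configs S (B - A) (m - i)"
        by auto
      then have c: "c \<in> configs S A i"
        by (auto simp: connected_configs_def)
      obtain p rs where g: "glue_configs A (c, c') = (p, rs)"
        by fastforce
      have "(p, rs) \<in> configs S B m"
        using glue_configs_in[OF c cc(3) fA fB] g i unfolding un by auto
      moreover have inv: "invariant p rs A"
        using glue_invariant[OF c cc(3) _ g] by blast
      moreover have "c = restrict_config A (p, rs)"
        using restrict_glue(1)[OF c cc(3)] g by simp
      then have "connected_on A p rs"
        using cc(2) connected_on_restrict[OF inv]
        by (auto simp: connected_configs_def restrict_config_def)
      ultimately show "glue_configs A cc \<in> ?L"
        using cc g by simp
    qed
  qed
  then have "card ?L = card (\<Union>i\<le>m. ?T i)"
    by (rule bij_betw_same_card)
  also have "\<dots> = (\<Sum>i\<le>m. card (?T i))"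
    using fA fB
    by (intro card_UN_disjoint)
      (auto simp: finite_configs finite_connected_configs, auto simp: connected_configs_def configs_def)
  finally show ?thesis
    by (simp add: card_cartesian_product)
qed

text \<open>The block is the intersection of all invariant subsets of \<open>B\<close> that contain
  \<open>x\<close>. If a nonempty invariant subset of it missed \<open>x\<close>, its complement in
  the block would be a smaller invariant set containing \<open>x\<close>.\<close>

lemma ex_connected_block:
  assumes "(p, rs) \<in> configs S B m" "finite B" "x \<in> B"
  shows "\<exists>A\<subseteq>B. x \<in> A \<and> invariant p rs A \<and> connected_on A p rs"
proof -
  have p: "p permutes B" and B: "invariant p rs B"
    using assms by (auto simp: configs_def invariant_def monotone_pairs_def permutes_in_image)
  define A where "A = \<Inter>{A. A \<subseteq> B \<and> x \<in> A \<and> invariant p rs A}"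
  have A: "A \<subseteq> B" "x \<in> A" "invariant p rs A"
    using assms(3) B unfolding A_def invariant_def by blast+
  have min: "A \<subseteq> A'" if "A' \<subseteq> B" "x \<in> A'" "invariant p rs A'" for A'
    using that by (auto simp: A_def)
  have "A' = A" if "A' \<subseteq> A" "A' \<noteq> {}" "invariant p rs A'" for A'
  proof (cases "x \<in> A'")
    case True
    then show ?thesis using min[of A'] that A by auto
  next
    case False
    have "invariant p rs (A - A')"
      using invariant_Diff[OF p _ that(3) A(3) that(1)] A(1) assms(2) finite_subset by blast
    then have "A \<subseteq> A - A'"
      using False A by (intro min) auto
    then show ?thesis using that by auto
  qed
  then show ?thesis
    using A by (auto simp: connected_on_def)
qed

text \<open>Split off the block of \<open>x\<close>.  The monotone list is recovered from its restrictions to the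
  block and to the complement, since equal larger entries occur on the same side.\<close>

lemma card_configs_rec:
  assumes "finite B" "x \<in> B"
  shows "card (configs S B m) = (\<Sum>A | A \<subseteq> B \<and> x \<in> A.
    \<Sum>i\<le>m. card (connected_configs S A i) * card (configs S (B - A) (m - i)))"
proof -
  let ?L = "\<lambda>A. {(p, rs) \<in> configs S B m. invariant p rs A \<and> connected_on A p rs}"
  have "configs S B m = (\<Union>A\<in>{A. A \<subseteq> B \<and> x \<in> A}. ?L A)"
  proof (intro equalityI subsetI)
    fix c assume "c \<in> configs S B m"
    moreover obtain p rs where "c = (p, rs)"
      by fastforce
    ultimately show "c \<in> (\<Union>A\<in>{A. A \<subseteq> B \<and> x \<in> A}. ?L A)"
      using ex_connected_block[OF _ assms, of p rs S m] by simp
  qed auto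
  also have "card \<dots> = (\<Sum>A | A \<subseteq> B \<and> x \<in> A. card (?L A))"
  proof (rule card_UN_disjoint)
    show "\<forall>A\<in>{A. A \<subseteq> B \<and> x \<in> A}. finite (?L A)"
      using finite_configs[OF assms(1)] by (auto intro: rev_finite_subset)
    \<comment> \<open>Uniqueness of the block: the intersection of two candidates is invariant and
      contains \<open>x\<close>, so by connectedness it equals both.\<close>
    have "A = A'" if "invariant p rs A" "invariant p rs A'" "connected_on A p rs"
      "connected_on A' p rs" "x \<in> A" "x \<in> A'" for p rs A A'
    proof -
      have "A \<inter> A' \<noteq> {}" "invariant p rs (A \<inter> A')"
        using that invariant_Int by auto
      then have "A \<inter> A' = A" "A \<inter> A' = A'"
        using that by (auto simp only: connected_on_def Int_lower1 Int_lower2)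
      then show ?thesis by auto
    qed
    then show "\<forall>A\<in>{A. A \<subseteq> B \<and> x \<in> A}. \<forall>A'\<in>{A. A \<subseteq> B \<and> x \<in> A}. A \<noteq> A' \<longrightarrow> ?L A \<inter> ?L A' = {}"
      by blast
  qed (use assms in simp)
  also have "\<dots> = (\<Sum>A | A \<subseteq> B \<and> x \<in> A.
    \<Sum>i\<le>m. card (connected_configs S A i) * card (configs S (B - A) (m - i)))"
    using assms by (intro sum.cong card_configs_block) auto
  finally show ?thesis .
qed

section \<open>Generating functions\<close>

text \<open>The variable marks transpositions and becomes \<open>hbar\<close> at the end. The shift
  of exponents by \<open>d / a\<close> is postponed to \<open>hbar_shift\<close>, so ordinary power
  series can be used here.\<close>

definition config_gf :: "nat set \<Rightarrow> nat set \<Rightarrow> rat fps" where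
  "config_gf S B = Abs_fps (\<lambda>m. of_nat (card (configs S B m)))"

definition connected_gf :: "nat set \<Rightarrow> nat set \<Rightarrow> rat fps" where
  "connected_gf S B = Abs_fps (\<lambda>m. of_nat (card (connected_configs S B m)))"

definition monotone_gf :: "nat set \<Rightarrow> rat fps" where
  "monotone_gf B = Abs_fps (\<lambda>m. of_nat (card {rs \<in> monotone_pairs B. length rs = m}))"

definition cycle_perms :: "nat set \<Rightarrow> nat set \<Rightarrow> (nat \<Rightarrow> nat) set" where
  "cycle_perms S B = {p. p permutes B \<and> (\<forall>x\<in>B. card (orbit p x) \<in> S)}"

lemma config_gf_rec:
  assumes "finite B" "x \<in> B"
  shows "config_gf S B = (\<Sum>A | A \<subseteq> B \<and> x \<in> A. connected_gf S A * config_gf S (B - A))"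
  by (rule fps_ext)
    (simp add: config_gf_def connected_gf_def fps_sum_nth fps_mult_nth card_configs_rec[OF assms] atMost_atLeast0)

section \<open>Factorization of \<open>config_gf\<close> and the series of monotone lists\<close>

lemma monotone_pairs_empty: "monotone_pairs {} = {[]}"
proof -
  have "rs = []" if "rs \<in> monotone_pairs {}" for rs
    using that by (cases rs) (auto simp: monotone_pairs_def)
  then show ?thesis
    by (auto simp: monotone_pairs_def)
qed

lemma configs_empty: "configs S {} m = (if m = 0 then {(id, [])} else {})"
  by (auto simp: configs_def monotone_pairs_empty)

lemma config_gf_empty: "config_gf S {} = 1"
  by (rule fps_ext) (simp add: config_gf_def configs_empty)

text \<open>Once connectedness is dropped, the permutation and the list are chosen independently;
  this is what makes the series computable.\<close>

lemma config_gf_eq: "config_gf S B = of_nat (card (cycle_perms S B)) * monotone_gf B"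
proof (rule fps_ext)
  fix m
  have "configs S B m = cycle_perms S B \<times> {rs \<in> monotone_pairs B. length rs = m}"
    by (auto simp: configs_def cycle_perms_def)
  then show "config_gf S B $ m = (of_nat (card (cycle_perms S B)) * monotone_gf B) $ m"
    by (simp add: config_gf_def monotone_gf_def card_cartesian_product fps_of_nat[symmetric]
        del: fps_of_nat)
qed

text \<open>As \<open>b\<close> exceeds all of \<open>B\<close>, the pairs with larger entry
  \<open>b\<close> stand at the end of the list. Either there is none, or the last pair is
  \<open>(r, b)\<close> with \<open>r \<in> B\<close>, and removing it leaves an arbitrary shorter
  list on \<open>insert b B\<close>.\<close>

lemma card_monotone_pairs_Suc:
  assumes "finite B" "\<forall>x\<in>B. x < b"
  shows "card {rs \<in> monotone_pairs (insert b B). length rs = Suc m} =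
    card {rs \<in> monotone_pairs B. length rs = Suc m} +
    card B * card {rs \<in> monotone_pairs (insert b B). length rs = m}"
proof -
  let ?M = "\<lambda>B m. {rs \<in> monotone_pairs B. length rs = m}"
  let ?f = "\<lambda>(ts, r). ts @ [(r, b)]"
  have "?M (insert b B) (Suc m) = ?M B (Suc m) \<union> ?f ` (?M (insert b B) m \<times> B)"
  proof (intro equalityI subsetI)
    fix rs assume rs: "rs \<in> ?M (insert b B) (Suc m)"
    then obtain ts r s where ts: "rs = ts @ [(r, s)]" "length ts = m"
      by (cases rs rule: rev_cases) auto
    have *: "r < s" "r \<in> insert b B" "s \<in> insert b B" "ts \<in> monotone_pairs (insert b B)"
      "\<forall>(r', s') \<in> set ts. r' < s' \<and> s' \<le> s \<and> r' \<in> insert b B \<and> s' \<in> insert b B"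
      using rs by (fastforce simp: ts monotone_pairs_def sorted_append)+
    show "rs \<in> ?M B (Suc m) \<union> ?f ` (?M (insert b B) m \<times> B)"
    proof (cases "s = b")
      case True
      then have "r \<in> B" using * by auto
      then show ?thesis using * ts True by force
    next
      case False
      then have s: "s \<in> B" "s < b" using * assms by auto
      have "r' \<in> B \<and> s' \<in> B \<and> r' < s'" if "(r', s') \<in> set rs" for r' s'
        using that * s ts by fastforce
      then show ?thesis using rs by (auto simp: monotone_pairs_def)
    qed
  next
    fix rs assume "rs \<in> ?M B (Suc m) \<union> ?f ` (?M (insert b B) m \<times> B)"
    then show "rs \<in> ?M (insert b B) (Suc m)"
    proof
      assume "rs \<in> ?M B (Suc m)"
      then show ?thesis by (auto simp: monotone_pairs_def)
    next
      assume "rs \<in> ?f ` (?M (insert b B) m \<times> B)"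
      then obtain ts r where ts: "rs = ts @ [(r, b)]" "ts \<in> ?M (insert b B) m" "r \<in> B"
        by auto
      have "s' \<in> insert b B" if "(r', s') \<in> set ts" for r' s'
        using ts(2) that by (auto simp: monotone_pairs_def)
      then have "s' \<le> b" if "(r', s') \<in> set ts" for r' s'
        using that assms(2) by (metis insert_iff less_imp_le order_refl)
      then show ?thesis
        using ts assms(2) by (auto simp: monotone_pairs_def sorted_append)
    qed
  qed
  moreover have "?M B (Suc m) \<inter> ?f ` (?M (insert b B) m \<times> B) = {}"
    using assms(2) by (auto simp: monotone_pairs_def)
  moreover have "inj_on ?f (?M (insert b B) m \<times> B)"
    by (auto simp: inj_on_def)
  ultimately show ?thesis
    using finite_monotone_pairs[of B] finite_monotone_pairs[of "insert b B" m] assms(1)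
    by (simp add: card_Un_disjoint card_image card_cartesian_product)
qed

lemma monotone_gf_0: "monotone_gf B $ 0 = 1"
proof -
  have "{rs \<in> monotone_pairs B. length rs = 0} = {[]}"
    by (auto simp: monotone_pairs_def)
  then show ?thesis
    by (simp add: monotone_gf_def)
qed

text \<open>The preceding recursion for series: if \<open>M'\<close> belongs to
  \<open>insert b B\<close> and \<open>M\<close> to \<open>B\<close>, then
  \<open>M' = M + card B * X * M'\<close>.\<close>

lemma monotone_gf_insert:
  assumes "finite B" "\<forall>x\<in>B. x < b"
  shows "monotone_gf (insert b B) * (1 - of_nat (card B) * fps_X) = monotone_gf B"
proof (rule fps_ext)
  fix m
  show "(monotone_gf (insert b B) * (1 - of_nat (card B) * fps_X)) $ m = monotone_gf B $ m"
  proof (cases m)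
    case 0
    then show ?thesis by (simp add: monotone_gf_0)
  next
    case (Suc k)
    have "(monotone_gf (insert b B) * (1 - of_nat (card B) * fps_X)) $ m =
      monotone_gf (insert b B) $ Suc k - of_nat (card B) * monotone_gf (insert b B) $ k"
      by (simp add: Suc ring_distribs fps_of_nat[symmetric] mult.left_commute[of _ "fps_const _"]
          del: fps_of_nat flip: mult.assoc)
    also have "\<dots> = monotone_gf B $ m"
      using card_monotone_pairs_Suc[OF assms, of k] by (simp add: Suc monotone_gf_def)
    finally show ?thesis .
  qed
qed

text \<open>The factor with index \<open>j\<close> comes from the element of \<open>B\<close> that
  has exactly \<open>j\<close> smaller ones. The form without division is the one that is later
  carried over to Laurent series.\<close>

lemma monotone_gf_prod:
  assumes "finite B"
  shows "monotone_gf B * (\<Prod>j<card B. 1 - of_nat j * fps_X) = 1"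
  using assms
proof (induction rule: finite_linorder_max_induct)
  case empty
  have "{rs \<in> monotone_pairs {}. length rs = m} = (if m = 0 then {[]} else {})" for m
    by (auto simp: monotone_pairs_empty)
  then show ?case
    by (auto simp: monotone_gf_def fps_eq_iff)
next
  case (insert b B)
  then have "b \<notin> B" by auto
  then have "monotone_gf (insert b B) * (\<Prod>j<card (insert b B). 1 - of_nat j * fps_X) =
    monotone_gf (insert b B) * (1 - of_nat (card B) * fps_X) * (\<Prod>j<card B. 1 - of_nat j * fps_X)"
    using insert by (simp add: mult_ac)
  then show ?case
    using insert monotone_gf_insert by simp
qed

lemma monotone_gf_eq:
  assumes "finite B"
  shows "monotone_gf B = inverse (\<Prod>j<card B. 1 - of_nat j * fps_X)"
  using monotone_gf_prod[OF assms] by (simp add: fps_inverse_unique mult.commute)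

text \<open>Removing \<open>x\<close> from \<open>A\<close> leaves an \<open>i\<close>-element
  subset of the other \<open>card B - 1\<close> points, whence the argument
  \<open>Suc i\<close>.\<close>

lemma sum_subsets_containing:
  fixes f :: "nat \<Rightarrow> 'a::comm_semiring_1"
  assumes "finite B" "x \<in> B"
  shows "(\<Sum>A | A \<subseteq> B \<and> x \<in> A. f (card A)) =
    (\<Sum>i<card B. of_nat ((card B - 1) choose i) * f (Suc i))"
proof -
  define C where "C = B - {x}"
  have C: "finite C" "x \<notin> C" "card B = Suc (card C)" "insert x C = B"
    using assms card_Suc_Diff1[OF assms] by (auto simp: C_def)
  have "(\<Sum>A | A \<subseteq> B \<and> x \<in> A. f (card A)) = (\<Sum>A\<in>Pow C. f (card (insert x A)))"
    by (rule sum.reindex_bij_witness[where i = "insert x" and j = "\<lambda>A. A - {x}"])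
      (auto simp: C_def insert_absorb insert_Diff assms)
  also have "\<dots> = (\<Sum>A\<in>Pow C. f (Suc (card A)))"
    using C by (intro sum.cong arg_cong[where f = f] card_insert_disjoint) (auto dest: finite_subset)
  also have "\<dots> = (\<Sum>i<card B. \<Sum>A | A \<in> Pow C \<and> card A = i. f (Suc (card A)))"
    using C by (intro sum.group[symmetric]) (auto simp: card_mono less_Suc_eq_le)
  also have "\<dots> = (\<Sum>i<card B. of_nat ((card B - 1) choose i) * f (Suc i))"
    using C by (intro sum.cong refl) (simp add: n_subsets)
  finally show ?thesis .
qed

section \<open>Counting permutations with prescribed cycle lengths\<close>

lemma cycle_perms_conv_configs: "card (cycle_perms S B) = card (configs S B 0)"
proof -
  have "configs S B 0 = cycle_perms S B \<times> {[]}"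
    by (auto simp: configs_def cycle_perms_def monotone_pairs_def)
  then show ?thesis
    by (simp add: card_cartesian_product)
qed

lemma card_cycle_perms_rec:
  assumes "finite B" "x \<in> B"
  shows "card (cycle_perms S B) =
    (\<Sum>A | A \<subseteq> B \<and> x \<in> A. card (connected_configs S A 0) * card (cycle_perms S (B - A)))"
  using card_configs_rec[OF assms, of S 0] by (simp add: cycle_perms_conv_configs)

text \<open>Without transpositions an orbit of \<open>p\<close> is already invariant, so
  connectedness forces \<open>p\<close> to be one cycle through all of \<open>A\<close>. Then
  \<open>S\<close> matters only through \<open>card A \<in> S\<close>.\<close>

lemma connected_configs_0:
  assumes "finite A" "A \<noteq> {}"
  shows "connected_configs S A 0 = (if card A \<in> S then connected_configs UNIV A 0 else {})"
proof -
  have "card (orbit p x) = card A" if "p permutes A" "connected_on A p []" "x \<in> A" for p x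
  proof -
    have "invariant p [] (orbit p x)"
      by (auto simp: invariant_def intro: orbit.intros)
    then have "orbit p x = A"
      using that permutes_orbit_subset[OF that(1,3)] orbit_nonempty[of p x]
      unfolding connected_on_def by blast
    then show ?thesis by simp
  qed
  then show ?thesis
    using assms(2) unfolding connected_configs_def configs_def by (auto 4 4)
qed

text \<open>With \<open>S = UNIV\<close> the left side of the recursion counts all permutations. By
  induction every size below \<open>card A\<close> of the cycle through \<open>x\<close> accounts
  for \<open>fact (card A - 1)\<close> permutations, and of the total \<open>fact (card A)\<close>
  the same amount is left for the full size.\<close>

lemma card_connected_configs_UNIV_0:
  assumes "finite A" "A \<noteq> {}"
  shows "card (connected_configs UNIV A 0) = fact (card A - 1)"
  using assms
proof (induction "card A" arbitrary: A rule: less_induct)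
  case less
  have perms: "card (cycle_perms UNIV B) = fact (card B)" if "finite B" for B
    using card_permutations[OF refl that] by (simp add: cycle_perms_def)
  obtain x where x: "x \<in> A"
    using less.prems by auto
  let ?n = "card A"
  let ?I = "{A'. A' \<subseteq> A \<and> x \<in> A'}"
  have n: "?n > 0"
    using less.prems by (simp add: card_gt_0_iff)
  have fI: "finite ?I" "A \<in> ?I"
    using less.prems x by auto
  define f where "f j = (fact (j - 1) * fact (?n - j) :: nat)" for j
  have "fact ?n = (\<Sum>A'\<in>?I. card (connected_configs UNIV A' 0) * fact (card (A - A')))"
    using card_cycle_perms_rec[OF less.prems(1) x, of UNIV] less.prems(1)
    by (simp add: perms)
  also have "\<dots> = card (connected_configs UNIV A 0) +
      (\<Sum>A'\<in>?I - {A}. card (connected_configs UNIV A' 0) * fact (card (A - A')))"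
    using fI by (subst sum.remove[of _ A]) auto
  also have "(\<Sum>A'\<in>?I - {A}. card (connected_configs UNIV A' 0) * fact (card (A - A'))) =
      (\<Sum>A'\<in>?I - {A}. f (card A'))"
  proof (rule sum.cong[OF refl])
    fix A' assume "A' \<in> ?I - {A}"
    then have A': "A' \<subset> A" "x \<in> A'" "finite A'"
      using less.prems(1) finite_subset by auto
    then have "card A' < card A"
      using less.prems(1) psubset_card_mono by blast
    then have "card (connected_configs UNIV A' 0) = fact (card A' - 1)"
      using A' less.hyps[of A'] by auto
    then show "card (connected_configs UNIV A' 0) * fact (card (A - A')) = f (card A')"
      using A' by (simp add: f_def card_Diff_subset)
  qed
  finally have 1: "fact ?n = card (connected_configs UNIV A 0) + (\<Sum>A'\<in>?I - {A}. f (card A'))" .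
  \<comment> \<open>Completing the sum by the expected top term \<open>f ?n\<close> gives the total
    \<open>fact ?n\<close> as well, so comparison with \<open>1\<close> identifies the top
    term.\<close>
  have "f ?n + (\<Sum>A'\<in>?I - {A}. f (card A')) = (\<Sum>A'\<in>?I. f (card A'))"
    using fI by (subst sum.remove[of _ A]) auto
  also have "\<dots> = (\<Sum>i<?n. ((?n - 1) choose i) * f (Suc i))"
    using sum_subsets_containing[OF less.prems(1) x, of f] by simp
  also have "\<dots> = (\<Sum>i<?n. fact (?n - 1))"
  proof (rule sum.cong[OF refl])
    fix i assume "i \<in> {..<?n}"
    then have "i \<le> ?n - 1" by auto
    from binomial_fact_lemma[OF this]
    show "((?n - 1) choose i) * f (Suc i) = fact (?n - 1)"
      by (simp add: f_def mult_ac)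
  qed
  also have "\<dots> = fact ?n"
    using n by (simp add: fact_reduce)
  finally have "card (connected_configs UNIV A 0) = f ?n"
    using 1 by linarith
  then show ?case
    by (simp add: f_def)
qed

text \<open>The cycle through a chosen point has \<open>a\<close> elements, so only blocks of size
  \<open>a\<close> survive in the recursion: there are \<open>(n - 1) choose (a - 1)\<close> of them
  with \<open>fact (a - 1)\<close> cycles each, and the rest is a set of \<open>n - a\<close>
  points.\<close>

lemma card_cycle_perms_singleton:
  assumes "a \<ge> 1" "finite B"
  shows "of_nat (card (cycle_perms {a} B)) =
    (if a dvd card B then fact (card B) / (of_nat a ^ (card B div a) * fact (card B div a)) else 0 :: rat)"
  using assms(2)
proof (induction "card B" arbitrary: B rule: less_induct)
  case less
  show ?case
  proof (cases "B = {}")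
    case True
    then show ?thesis
      by (simp add: cycle_perms_conv_configs configs_empty)
  next
    case False
    then obtain x where x: "x \<in> B" by auto
    let ?n = "card B"
    define g where "g n = (if a dvd n then fact n / (of_nat a ^ (n div a) * fact (n div a)) else 0 :: rat)" for n
    define f where "f j = (if j = a then fact (a - 1) * g (?n - a) else 0 :: rat)" for j
    have n: "?n > 0"
      using less.prems x by (auto simp: card_gt_0_iff)
    have "of_nat (card (cycle_perms {a} B)) = (\<Sum>A | A \<subseteq> B \<and> x \<in> A.
        of_nat (card (connected_configs {a} A 0)) * (of_nat (card (cycle_perms {a} (B - A))) :: rat))"
      by (subst card_cycle_perms_rec[OF less.prems x]) simp
    also have "\<dots> = (\<Sum>A | A \<subseteq> B \<and> x \<in> A. f (card A))"
    proof (rule sum.cong[OF refl])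
      fix A assume "A \<in> {A. A \<subseteq> B \<and> x \<in> A}"
      then have A: "A \<subseteq> B" "x \<in> A" "finite A"
        using less.prems finite_subset by auto
      show "of_nat (card (connected_configs {a} A 0)) * (of_nat (card (cycle_perms {a} (B - A))) :: rat) = f (card A)"
      proof (cases "card A = a")
        case True
        have c: "card (B - A) = ?n - a"
          using A True by (simp add: card_Diff_subset)
        have "of_nat (card (cycle_perms {a} (B - A))) = g (card (B - A))"
          unfolding g_def using less.hyps[of "B - A"] less.prems n assms(1) c by simp
        moreover have "card (connected_configs {a} A 0) = fact (a - 1)"
          using A(2,3) True card_connected_configs_UNIV_0[of A] connected_configs_0[of A "{a}"]
          by fastforce
        ultimately show ?thesis
          using True c by (simp add: f_def)
      next
        case False
        then show ?thesis
          using A(2,3) connected_configs_0[of A "{a}"] by (fastforce simp: f_def)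
      qed
    qed
    also have "\<dots> = (\<Sum>i<?n. of_nat ((?n - 1) choose i) * f (Suc i))"
      by (rule sum_subsets_containing[OF less.prems x])
    also have "\<dots> = (\<Sum>i<?n. if i = a - 1 then of_nat ((?n - 1) choose i) * (fact (a - 1) * g (?n - a)) else 0)"
      using assms(1) by (intro sum.cong) (auto simp: f_def)
    also have "\<dots> = (if a \<le> ?n then of_nat ((?n - 1) choose (a - 1)) * (fact (a - 1) * g (?n - a)) else 0)"
      using assms(1) n by (auto simp: sum.delta)
    also have "\<dots> = g ?n"
    proof (cases "a \<le> ?n \<and> a dvd ?n")
      case True
      then obtain k where "?n = a * k" by auto
      then obtain l where k: "?n = a * Suc l"
        using n by (cases k) auto
      have "?n - 1 - (a - 1) = a * l" "?n - a = a * l"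
        using k assms(1) by auto
      then have "of_nat ((?n - 1) choose (a - 1)) * fact (a - 1) * fact (a * l) = (fact (?n - 1) :: rat)"
        using binomial_fact_lemma[of "a - 1" "?n - 1"] True
        by (metis (no_types, lifting) diff_le_mono mult.assoc mult.commute of_nat_fact of_nat_mult)
      then have "of_nat ((?n - 1) choose (a - 1)) * (fact (a - 1) * g (?n - a)) =
        (fact (?n - 1) :: rat) / (of_nat a ^ l * fact l)"
        using \<open>?n - a = a * l\<close> assms(1) by (simp add: g_def)
      also have "\<dots> = fact ?n / (of_nat a ^ Suc l * fact (Suc l))"
      proof -
        have "(fact ?n :: rat) = of_nat (a * Suc l) * fact (?n - 1)"
          using n k by (metis fact_reduce)
        moreover have "of_nat (a * Suc l) * x / (of_nat a ^ Suc l * fact (Suc l)) =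
            x / (of_nat a ^ l * fact l)" for x :: rat
          using assms(1) by (simp add: divide_simps del: of_nat_Suc mult_Suc_right)
        ultimately show ?thesis
          by simp
      qed
      also have "\<dots> = g ?n"
        using k assms(1) by (simp add: g_def del: mult_Suc_right)
      finally show ?thesis
        using True by simp
    next
      \<comment> \<open>Either \<open>a\<close> exceeds the positive number \<open>?n\<close> and
        cannot divide it, or \<open>a\<close> divides neither \<open>?n\<close> nor
        \<open>?n - a\<close>; both sides are \<open>0\<close>.\<close>
      case False
      then show ?thesis
        using n assms(1) by (auto simp: g_def dvd_imp_le dvd_diff_nat dest: dvd_diffD)
    qed
    finally show ?thesis
      by (simp add: g_def)
  qed
qed

section \<open>Dependence on the cardinality alone\<close>

lemma config_gf_singleton:
  assumes "a \<ge> 1" "finite B"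
  shows "config_gf {a} B = config_gf {a} {1..card B}"
proof -
  have "of_nat (card (cycle_perms {a} B)) = (of_nat (card (cycle_perms {a} {1..card B})) :: rat)"
    using card_cycle_perms_singleton[OF assms(1)] assms(2) by simp
  then show ?thesis
    using assms(2) by (simp add: config_gf_eq monotone_gf_eq)
qed

text \<open>In the recursion the term \<open>A = B\<close> is \<open>connected_gf {a} B\<close>
  itself, because the factor for the empty complement is \<open>1\<close>. Every other term is fixed
  by cardinalities, by induction.\<close>

lemma connected_gf_singleton:
  assumes "a \<ge> 1" "finite A" "A \<noteq> {}"
  shows "connected_gf {a} A = connected_gf {a} {1..card A}"
  using assms(2,3)
proof (induction "card A" arbitrary: A rule: less_induct)
  case less
  let ?D = "\<lambda>n. config_gf {a} {1..n}" and ?C = "\<lambda>n. connected_gf {a} {1..n}"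
  \<comment> \<open>\<open>f n n\<close> is set to \<open>0\<close>, so that the top term may be put
    back into the sum before it is regrouped by size. The formula \<open>*\<close> is proved for all
    sets as large as \<open>A\<close>, to be applied both to \<open>A\<close> and to the
    interval.\<close>
  define f where "f n j = (if j < n then ?C j * ?D (n - j) else 0)" for n j
  have *: "connected_gf {a} B = ?D (card B) - (\<Sum>i<card B. of_nat ((card B - 1) choose i) * f (card B) (Suc i))"
    if B: "finite B" "B \<noteq> {}" "card B = card A" for B
  proof -
    obtain x where x: "x \<in> B" using B by auto
    let ?I = "{A. A \<subseteq> B \<and> x \<in> A}"
    have I: "finite ?I" "B \<in> ?I" using B x by auto
    have "?D (card B) = (\<Sum>A'\<in>?I. connected_gf {a} A' * config_gf {a} (B - A'))"
      using config_gf_rec[OF B(1) x, of "{a}"] config_gf_singleton[OF assms(1) B(1)] by simp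
    also have "\<dots> = connected_gf {a} B + (\<Sum>A'\<in>?I - {B}. connected_gf {a} A' * config_gf {a} (B - A'))"
      using I by (subst sum.remove[of _ B]) (auto simp: config_gf_empty)
    also have "(\<Sum>A'\<in>?I - {B}. connected_gf {a} A' * config_gf {a} (B - A')) = (\<Sum>A'\<in>?I - {B}. f (card B) (card A'))"
    proof (rule sum.cong[OF refl])
      fix A' assume "A' \<in> ?I - {B}"
      then have A': "A' \<subset> B" "A' \<noteq> {}" "finite A'"
        using B(1) finite_subset by auto
      then have "card A' < card B"
        using B psubset_card_mono by blast
      moreover from this have "connected_gf {a} A' = ?C (card A')"
        using A' less.hyps B by auto
      moreover have "config_gf {a} (B - A') = ?D (card B - card A')"
        using config_gf_singleton[OF assms(1), of "B - A'"] A' B by (simp add: card_Diff_subset)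
      ultimately show "connected_gf {a} A' * config_gf {a} (B - A') = f (card B) (card A')"
        by (simp add: f_def)
    qed
    also have "\<dots> = (\<Sum>A'\<in>?I. f (card B) (card A'))"
      using I by (subst (2) sum.remove[of _ B]) (auto simp: f_def)
    also have "\<dots> = (\<Sum>i<card B. of_nat ((card B - 1) choose i) * f (card B) (Suc i))"
      by (rule sum_subsets_containing[OF B(1) x])
    finally show ?thesis by simp
  qed
  have "{1..card A} \<noteq> {}"
    using less.prems by (simp add: Suc_le_eq card_gt_0_iff)
  then show ?case
    using *[of A, unfolded card_atLeastAtMost] *[of "{1..card A}", unfolded card_atLeastAtMost]
      less.prems by simp
qed

text \<open>The distinguished point is \<open>1\<close>; the binomial coefficient chooses the other
  \<open>i\<close> points of its block, and becomes a Cauchy product after division by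
  factorials.\<close>

lemma config_gf_binomial_rec:
  assumes "a \<ge> 1" "n \<ge> 1"
  shows "config_gf {a} {1..n} = (\<Sum>i<n. of_nat ((n - 1) choose i) *
    (connected_gf {a} {1..Suc i} * config_gf {a} {1..n - Suc i}))"
proof -
  have "config_gf {a} {1..n} = (\<Sum>A | A \<subseteq> {1..n} \<and> 1 \<in> A. connected_gf {a} A * config_gf {a} ({1..n} - A))"
    using assms by (intro config_gf_rec) auto
  also have "\<dots> = (\<Sum>A | A \<subseteq> {1..n} \<and> 1 \<in> A.
      (\<lambda>j. connected_gf {a} {1..j} * config_gf {a} {1..n - j}) (card A))"
  proof (rule sum.cong[OF refl])
    fix A assume "A \<in> {A. A \<subseteq> {1..n} \<and> 1 \<in> A}"
    then have A: "A \<subseteq> {1..n}" "A \<noteq> {}" "finite A"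
      using finite_subset by auto
    then have "card ({1..n} - A) = n - card A"
      by (simp add: card_Diff_subset)
    then show "connected_gf {a} A * config_gf {a} ({1..n} - A) =
        (\<lambda>j. connected_gf {a} {1..j} * config_gf {a} {1..n - j}) (card A)"
      using connected_gf_singleton[OF assms(1) A(3,2)] config_gf_singleton[OF assms(1), of "{1..n} - A"]
      by simp
  qed
  also have "\<dots> = (\<Sum>i<n. of_nat ((n - 1) choose i) *
    (connected_gf {a} {1..Suc i} * config_gf {a} {1..n - Suc i}))"
    using sum_subsets_containing[of "{1..n}" 1 "\<lambda>j. connected_gf {a} {1..j} * config_gf {a} {1..n - j}"] assms
    by simp
  finally show ?thesis .
qed

section \<open>Cycles of a product with transpositions\<close>

abbreviation cycle_count :: "nat set \<Rightarrow> (nat \<Rightarrow> nat) \<Rightarrow> nat" where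
  "cycle_count B p \<equiv> card (orbit p ` B)"

lemma invariant_Un: "invariant p rs A \<Longrightarrow> invariant p rs A' \<Longrightarrow> invariant p rs (A \<union> A')"
  by (auto simp: invariant_def)

lemma orbit_subset_stable:
  assumes "x \<in> A" "\<forall>y\<in>A. p y \<in> A"
  shows "orbit p x \<subseteq> A"
proof
  fix y assume "y \<in> orbit p x"
  then show "y \<in> A"
    by induction (use assms in auto)
qed

lemma orbit_eq_of_mem:
  assumes "p permutes B" "finite B" "y \<in> orbit p x"
  shows "orbit p y = orbit p x"
  using cyclic_on_orbit[OF assms(1,2)] assms(3) by (rule orbit_cyclic_eq3)

lemma orbits_disjoint:
  assumes "p permutes B" "finite B" "c \<in> orbit p ` B" "c' \<in> orbit p ` B" "c \<noteq> c'"
  shows "c \<inter> c' = {}"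
proof -
  obtain x x' where c: "c = orbit p x" "c' = orbit p x'"
    using assms(3,4) by blast
  then have "c = c'" if "y \<in> c" "y \<in> c'" for y
    using that orbit_eq_of_mem[OF assms(1,2), of y x] orbit_eq_of_mem[OF assms(1,2), of y x'] by simp
  then show ?thesis
    using assms(5) by auto
qed

lemma Union_orbits: "p permutes B \<Longrightarrow> finite B \<Longrightarrow> \<Union>(orbit p ` B) = B"
  using permutes_orbit_subset[of p B] permutes_self_in_orbit[of p B] by blast

text \<open>If \<open>s\<close> were not in \<open>X\<close>, the transposition would act trivially
  on \<open>X \<inter> orbit p s\<close>, as \<open>r\<close> lies in another cycle. This set would
  then be stable under \<open>p\<close>; it contains \<open>p s\<close>, the image of
  \<open>r\<close>, hence the whole cycle including \<open>s\<close>.\<close>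

lemma orbit_transpose_join:
  assumes p: "p permutes B" "finite B" and rs: "r \<noteq> s" "s \<notin> orbit p r"
    and X: "\<forall>x\<in>X. (p \<circ> transpose r s) x \<in> X" "r \<in> X"
  shows "s \<in> X"
proof (rule ccontr)
  assume s: "s \<notin> X"
  let ?Y = "X \<inter> orbit p s"
  have r: "r \<notin> orbit p s"
    using orbit_eq_of_mem[OF p, of r s] permutes_self_in_orbit[OF p] rs(2) by auto
  have st: "\<forall>y\<in>?Y. p y \<in> ?Y"
  proof
    fix y assume y: "y \<in> ?Y"
    then have "y \<noteq> r" "y \<noteq> s"
      using r s by auto
    then show "p y \<in> ?Y"
      using y X(1)[rule_format, of y] by (auto intro: orbit.step)
  qed
  have ps: "p s \<in> ?Y"
    using X(1)[rule_format, OF X(2)] by (simp add: orbit.base)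
  have "orbit p (p s) \<subseteq> ?Y"
    by (rule orbit_subset_stable[OF ps st])
  moreover have "s \<in> orbit p (p s)"
    unfolding orbit_eq_of_mem[OF p orbit.base[of p s]] by (rule permutes_self_in_orbit[OF p])
  ultimately show False
    using s by auto
qed

lemma orbit_transpose_merge:
  assumes p: "p permutes B" "finite B" and rs: "r \<noteq> s" "s \<notin> orbit p r" "r \<in> B" "s \<in> B"
  shows "orbit (p \<circ> transpose r s) r = orbit p r \<union> orbit p s"
    and "orbit (p \<circ> transpose r s) s = orbit p r \<union> orbit p s"
proof -
  let ?q = "p \<circ> transpose r s"
  have q: "?q permutes B"
    using p rs by (intro permutes_compose permutes_swap_id)
  have stab: "\<forall>x\<in>orbit ?q r. ?q x \<in> orbit ?q r"
    using orbit.step[of _ ?q r] by blast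
  have r: "r \<in> orbit ?q r"
    by (rule permutes_self_in_orbit[OF q p(2)])
  have s: "s \<in> orbit ?q r"
    using orbit_transpose_join[OF p rs(1,2) stab r] .
  \<comment> \<open>\<open>p\<close> and \<open>?q\<close> differ only by exchanging the images of
    \<open>r\<close> and \<open>s\<close>, and both points lie in this orbit.\<close>
  have pstab: "\<forall>x\<in>orbit ?q r. p x \<in> orbit ?q r"
  proof
    fix x assume "x \<in> orbit ?q r"
    then have "?q x \<in> orbit ?q r" "?q r \<in> orbit ?q r" "?q s \<in> orbit ?q r"
      using stab r s by blast+
    then show "p x \<in> orbit ?q r"
      by (cases "x = r"; cases "x = s") auto
  qed
  have "orbit p r \<union> orbit p s \<subseteq> orbit ?q r"
    using orbit_subset_stable[OF r pstab] orbit_subset_stable[OF s pstab] by blast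
  moreover have "orbit ?q r \<subseteq> orbit p r \<union> orbit p s"
  proof (rule orbit_subset_stable)
    show "r \<in> orbit p r \<union> orbit p s"
      using permutes_self_in_orbit[OF p] by auto
    show "\<forall>x\<in>orbit p r \<union> orbit p s. ?q x \<in> orbit p r \<union> orbit p s"
      by (auto simp: transpose_def intro: orbit.intros)
  qed
  ultimately show "orbit ?q r = orbit p r \<union> orbit p s"
    by blast
  then show "orbit ?q s = orbit p r \<union> orbit p s"
    using orbit_eq_of_mem[OF q p(2) s] by simp
qed

text \<open>The cycles of \<open>r\<close> and \<open>s\<close> are replaced by their union, and all
  others are untouched.\<close>

lemma cycle_count_merge:
  assumes p: "p permutes B" "finite B" and rs: "r \<noteq> s" "s \<notin> orbit p r" "r \<in> B" "s \<in> B"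
  shows "Suc (cycle_count B (p \<circ> transpose r s)) = cycle_count B p"
proof -
  let ?q = "p \<circ> transpose r s"
  let ?R = "orbit p r" and ?S = "orbit p s"
  let ?C = "orbit p ` (B - (?R \<union> ?S))"
  note self = permutes_self_in_orbit[OF p]
  have other: "orbit ?q x = orbit p x" if "x \<in> B - (?R \<union> ?S)" for x
  proof (rule orbit_cong[OF self])
    fix y assume y: "y \<in> orbit p x"
    then have "y \<noteq> r" "y \<noteq> s"
      using that orbit_eq_of_mem[OF p, of y x] self by auto
    then show "?q y = p y" by simp
  qed
  have RS: "?R \<noteq> ?S" and sub: "?R \<subseteq> B" "?S \<subseteq> B"
    using rs self permutes_orbit_subset[OF p(1)] by auto
  have notin: "?R \<notin> ?C" "?S \<notin> ?C" "?R \<union> ?S \<notin> ?C"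
    using self orbit_eq_of_mem[OF p] by fastforce+
  have q: "?q permutes B"
    using p rs by (intro permutes_compose permutes_swap_id)
  have "orbit p ` (?R \<union> ?S) = {?R, ?S}"
    using orbit_eq_of_mem[OF p] self by auto
  moreover have "B = (B - (?R \<union> ?S)) \<union> (?R \<union> ?S)"
    using sub by auto
  ultimately have "orbit p ` B = ?C \<union> {?R, ?S}"
    using image_Un[of "orbit p" "B - (?R \<union> ?S)" "?R \<union> ?S"] by simp
  then have "orbit p ` B = insert ?R (insert ?S ?C)"
    by blast
  then have 1: "cycle_count B p = Suc (Suc (card ?C))"
    using RS notin p(2) by simp
  have "orbit ?q x = ?R \<union> ?S" if "x \<in> ?R \<union> ?S" for x
  proof -
    have "x \<in> orbit ?q r"
      using that orbit_transpose_merge[OF p rs] by simp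
    then show ?thesis
      using orbit_eq_of_mem[OF q p(2), of x r] orbit_transpose_merge[OF p rs] by simp
  qed
  then have "orbit ?q ` (?R \<union> ?S) = {?R \<union> ?S}"
    using self[of r] by auto
  moreover have "orbit ?q ` (B - (?R \<union> ?S)) = ?C"
    using other by (intro image_cong) auto
  moreover have "orbit ?q ` B = orbit ?q ` (B - (?R \<union> ?S)) \<union> orbit ?q ` (?R \<union> ?S)"
    using sub by (auto simp flip: image_Un)
  ultimately have "orbit ?q ` B = insert (?R \<union> ?S) ?C"
    by auto
  then show ?thesis
    using 1 notin p(2) by simp
qed

text \<open>Follow \<open>p\<close> from \<open>s\<close> until \<open>r\<close> is reached for the
  first time. The points after \<open>s\<close>, up to and including \<open>r\<close>, are stable
  under \<open>?q\<close>, which agrees with \<open>p\<close> before \<open>r\<close> and sends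
  \<open>r\<close> back to \<open>p s\<close>; \<open>s\<close> is not among them.\<close>

lemma orbit_transpose_split:
  assumes p: "p permutes B" "finite B" and rs: "r \<noteq> s" "s \<in> orbit p r"
  shows "s \<notin> orbit (p \<circ> transpose r s) r"
proof -
  let ?q = "p \<circ> transpose r s"
  have "r \<in> orbit p s"
    using orbit_eq_of_mem[OF p rs(2)] permutes_self_in_orbit[OF p] by simp
  then have ex: "\<exists>n. 0 < n \<and> (p ^^ n) s = r"
    by (auto simp: orbit_altdef)
  define n where "n = (LEAST n. 0 < n \<and> (p ^^ n) s = r)"
  have n: "0 < n" "(p ^^ n) s = r"
    using LeastI_ex[OF ex] by (auto simp: n_def)
  have least: "(p ^^ i) s \<noteq> r" if "0 < i" "i < n" for i
    using not_less_Least[of i "\<lambda>n. 0 < n \<and> (p ^^ n) s = r"] that by (auto simp: n_def)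
  define X where "X = (\<lambda>i. (p ^^ i) s) ` {1..n}"
  have s: "(p ^^ i) s \<noteq> s" if i: "0 < i" "i \<le> n" for i
  proof
    assume eq: "(p ^^ i) s = s"
    show False
    proof (cases "i = n")
      case True
      then show False using eq n rs(1) by simp
    next
      case False
      \<comment> \<open>A return to \<open>s\<close> at time \<open>i\<close> would make the orbit
        reach \<open>r\<close> already at time \<open>n - i\<close>, against minimality of
        \<open>n\<close>.\<close>
      have "(p ^^ (n - i)) ((p ^^ i) s) = r"
        using i n(2) by (simp flip: funpow_add comp_apply[of "p ^^ (n - i)" "p ^^ i"])
      then show False
        using eq least[of "n - i"] i False by simp
    qed
  qed
  have "\<forall>x\<in>X. ?q x \<in> X"
  proof
    fix x assume "x \<in> X"
    then obtain i where i: "x = (p ^^ i) s" "1 \<le> i" "i \<le> n"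
      by (auto simp: X_def)
    show "?q x \<in> X"
    proof (cases "i = n")
      case True
      then have "?q x = (p ^^ 1) s"
        using i n by simp
      then show ?thesis
        unfolding X_def using n by (intro image_eqI[of _ _ 1]) auto
    next
      case False
      then have "?q x = (p ^^ Suc i) s"
        using i least[of i] s[of i] by simp
      then show ?thesis
        unfolding X_def using i False by (intro image_eqI[of _ _ "Suc i"]) auto
    qed
  qed
  moreover have "r \<in> X"
    unfolding X_def using n by (intro image_eqI[of _ _ n]) auto
  ultimately have "orbit ?q r \<subseteq> X"
    by (intro orbit_subset_stable)
  moreover have "s \<notin> X"
    unfolding X_def image_iff using s by (metis Suc_le_eq One_nat_def atLeastAtMost_iff)
  ultimately show ?thesis
    by (meson subsetD)
qed

text \<open>Merging read backwards: the transposition is an involution, and after the multiplication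
  \<open>r\<close> and \<open>s\<close> lie in different cycles.\<close>

lemma cycle_count_split:
  assumes p: "p permutes B" "finite B" and rs: "r \<noteq> s" "s \<in> orbit p r" "r \<in> B" "s \<in> B"
  shows "cycle_count B (p \<circ> transpose r s) = Suc (cycle_count B p)"
proof -
  have q: "(p \<circ> transpose r s) permutes B"
    using p rs by (intro permutes_compose permutes_swap_id)
  have "p \<circ> transpose r s \<circ> transpose r s = p"
    by (simp add: comp_assoc)
  then show ?thesis
    using cycle_count_merge[OF q p(2) rs(1) orbit_transpose_split[OF p rs(1,2)] rs(3,4)] by simp
qed

section \<open>Parity and genus bound for a product of transpositions\<close>

definition pairs_product :: "(nat \<times> nat) list \<Rightarrow> nat \<Rightarrow> nat" where
  "pairs_product rs = foldr (\<circ>) (map (\<lambda>(r, s). transpose r s) rs) id"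

lemma foldr_comp: "foldr (\<circ>) fs g = foldr (\<circ>) fs id \<circ> g"
  by (induction fs) (auto simp: comp_assoc)

text \<open>The last pair acts first, so appending a pair multiplies on the right, where the merge
  and split lemmas apply. This is why the inductions below run from the end of the list.\<close>

lemma pairs_product_snoc: "pairs_product (rs @ [(r, s)]) = pairs_product rs \<circ> transpose r s"
  by (simp add: pairs_product_def foldr_comp[of _ "transpose r s"])

lemma pairs_product_permutes:
  assumes "\<forall>(r, s) \<in> set rs. r \<in> B \<and> s \<in> B"
  shows "pairs_product rs permutes B"
  using assms
  by (induction rs) (auto simp: pairs_product_def permutes_id intro!: permutes_compose permutes_swap_id)

lemma product_stable:
  assumes "invariant p rs A" "x \<in> A"
  shows "(p \<circ> pairs_product rs) x \<in> A"
proof -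
  have "(\<forall>(r, s) \<in> set rs. r \<in> A \<longleftrightarrow> s \<in> A) \<Longrightarrow> pairs_product rs x \<in> A"
    by (induction rs) (use assms(2) in \<open>auto simp: pairs_product_def transpose_def\<close>)
  then show ?thesis
    using assms by (auto simp: invariant_def)
qed

text \<open>Each transposition changes the number of cycles by exactly one. The parity is what makes
  the genus an integer.\<close>

lemma even_cycle_count_product:
  assumes "p permutes B" "finite B" "\<forall>(r, s) \<in> set rs. r \<in> B \<and> s \<in> B \<and> r \<noteq> s"
  shows "even (cycle_count B (p \<circ> pairs_product rs) + cycle_count B p + length rs)"
  using assms(3)
proof (induction rs rule: rev_induct)
  case Nil
  then show ?case by (simp add: pairs_product_def)
next
  case (snoc x rs)
  obtain r s where x: "x = (r, s)" by fastforce
  let ?q = "p \<circ> pairs_product rs"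
  have "?q permutes B"
    using assms(1) snoc.prems by (intro permutes_compose pairs_product_permutes) auto
  moreover have "r \<in> B" "s \<in> B" "r \<noteq> s"
    using snoc.prems x by auto
  ultimately have "cycle_count B (?q \<circ> transpose r s) = Suc (cycle_count B ?q) \<or>
      Suc (cycle_count B (?q \<circ> transpose r s)) = cycle_count B ?q"
    using cycle_count_merge[of ?q B r s] cycle_count_split[of ?q B r s] assms(2) by blast
  then have "even (cycle_count B (?q \<circ> transpose r s) + cycle_count B ?q + 1)"
    by presburger
  moreover have "even (cycle_count B ?q + cycle_count B p + length rs)"
    by (rule snoc.IH) (use snoc.prems in auto)
  moreover have "even (i + k + Suc l)" if "even (i + j + 1)" "even (j + k + l)" for i j k l :: nat
    using that by presburger
  ultimately have "even (cycle_count B (?q \<circ> transpose r s) + cycle_count B p + Suc (length rs))"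
    by blast
  moreover have "p \<circ> pairs_product (rs @ [x]) = ?q \<circ> transpose r s"
    by (simp add: x pairs_product_snoc comp_assoc)
  ultimately show ?case
    by (simp only: length_append_singleton)
qed

text \<open>Track a partition into invariant blocks along the product.  A transposition inside one block
  creates at most one cycle; a transposition between two blocks merges two cycles and is paid for by
  merging the blocks.\<close>

lemma ex_invariant_partition:
  assumes "p permutes B" "finite B" "\<forall>(r, s) \<in> set rs. r \<in> B \<and> s \<in> B \<and> r \<noteq> s"
  shows "\<exists>P. \<Union>P = B \<and> {} \<notin> P \<and> (\<forall>A\<in>P. \<forall>A'\<in>P. A \<noteq> A' \<longrightarrow> A \<inter> A' = {}) \<and> (\<forall>A\<in>P. invariant p rs A) \<and>
    cycle_count B (p \<circ> pairs_product rs) + cycle_count B p \<le> length rs + 2 * card P"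
  using assms(3)
proof (induction rs rule: rev_induct)
  case Nil
  \<comment> \<open>With no transpositions the orbits of \<open>p\<close> serve as blocks, and the
    bound is an equality.\<close>
  let ?P = "orbit p ` B"
  have "\<Union>?P = B"
    by (rule Union_orbits[OF assms(1,2)])
  moreover have "\<forall>A\<in>?P. \<forall>A'\<in>?P. A \<noteq> A' \<longrightarrow> A \<inter> A' = {}"
    using orbits_disjoint[OF assms(1,2)] by blast
  moreover have "{} \<notin> ?P"
    using orbit_nonempty[of p] by auto
  moreover have "\<forall>A\<in>?P. invariant p [] A"
    by (auto simp: invariant_def intro: orbit.step)
  ultimately show ?case
    by (intro exI[of _ ?P]) (simp add: pairs_product_def)
next
  case (snoc x rs)
  obtain r s where x: "x = (r, s)" by fastforce
  let ?q = "p \<circ> pairs_product rs"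
  have q: "?q permutes B"
    using assms(1) snoc.prems by (intro permutes_compose pairs_product_permutes) auto
  have rs: "r \<in> B" "s \<in> B" "r \<noteq> s"
    using snoc.prems x by auto
  obtain P where P: "\<Union>P = B" "{} \<notin> P" "\<forall>A\<in>P. \<forall>A'\<in>P. A \<noteq> A' \<longrightarrow> A \<inter> A' = {}" "\<forall>A\<in>P. invariant p rs A"
    "cycle_count B ?q + cycle_count B p \<le> length rs + 2 * card P"
  proof -
    have "\<forall>(r, s)\<in>set rs. r \<in> B \<and> s \<in> B \<and> r \<noteq> s"
      using snoc.prems by auto
    from snoc.IH[OF this] show ?thesis
      using that by blast
  qed
  have fP: "finite P"
    using P(1) assms(2) by (intro finite_UnionD) simp
  have prod: "p \<circ> pairs_product (rs @ [x]) = ?q \<circ> transpose r s"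
    by (simp add: x pairs_product_snoc comp_assoc)
  obtain R S where RS: "R \<in> P" "S \<in> P" "r \<in> R" "s \<in> S"
    using rs P(1) by blast
  have inv_snoc: "invariant p (rs @ [x]) A \<longleftrightarrow> invariant p rs A \<and> (r \<in> A \<longleftrightarrow> s \<in> A)" for A
    by (auto simp: invariant_def x)
  show ?case
  proof (cases "R = S")
    case True
    have "\<forall>A\<in>P. invariant p (rs @ [x]) A"
    proof
      fix A assume A: "A \<in> P"
      have "r \<in> A \<longleftrightarrow> s \<in> A"
        using P(3) A RS True by blast
      then show "invariant p (rs @ [x]) A"
        using P(4) A by (simp add: inv_snoc)
    qed
    moreover have "cycle_count B (?q \<circ> transpose r s) \<le> Suc (cycle_count B ?q)"
      using cycle_count_merge[OF q assms(2) rs(3) _ rs(1,2)] cycle_count_split[OF q assms(2) rs(3) _ rs(1,2)]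
      by (cases "s \<in> orbit ?q r") auto
    ultimately show ?thesis
      using P(1-3) P(5) unfolding prod by (intro exI[of _ P]) (simp del: o_apply)
  next
    case False
    have RSd: "R \<inter> S = {}"
      using P(3) RS False by blast
    have "orbit ?q r \<subseteq> R"
      using product_stable P(4) RS by (intro orbit_subset_stable) auto
    then have "s \<notin> orbit ?q r"
      using RSd RS by auto
    from cycle_count_merge[OF q assms(2) rs(3) this rs(1,2)]
    have m: "Suc (cycle_count B (?q \<circ> transpose r s)) = cycle_count B ?q" .
    \<comment> \<open>One cycle fewer on the left; on the right one transposition more and one block
      fewer, that is \<open>1 - 2 = -1\<close>.\<close>
    let ?P = "insert (R \<union> S) (P - {R, S})"
    have dis: "A \<inter> (R \<union> S) = {}" if "A \<in> P - {R, S}" for A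
      using P(3) RS that by blast
    have "R \<union> S \<notin> P - {R, S}"
      using dis RS by blast
    then have "card ?P = Suc (card (P - {R, S}))"
      using fP by simp
    moreover have "P = insert R (insert S (P - {R, S}))"
      using RS by auto
    then have "card P = Suc (Suc (card (P - {R, S})))"
      using fP False by (metis Diff_iff card_insert_disjoint finite_Diff finite_insert insert_iff)
    ultimately have card: "Suc (card ?P) = card P"
      by simp
    have "\<Union>?P = B"
      using P(1) RS by blast
    moreover have "{} \<notin> ?P"
      using P(2) RS by auto
    moreover have "\<forall>A\<in>?P. \<forall>A'\<in>?P. A \<noteq> A' \<longrightarrow> A \<inter> A' = {}"
      using dis P(3) by (simp add: Int_commute)
    moreover have "\<forall>A\<in>?P. invariant p (rs @ [x]) A"
    proof
      fix A assume "A \<in> ?P"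
      then consider "A = R \<union> S" | "A \<in> P - {R, S}" by (rule insertE)
      then show "invariant p (rs @ [x]) A"
      proof cases
        case 1
        moreover have "invariant p rs (R \<union> S)"
          using P(4) RS(1,2) by (intro invariant_Un) simp_all
        ultimately show ?thesis
          using RS by (simp add: inv_snoc)
      next
        case 2
        then show ?thesis
          using P(4) RS dis[OF 2] by (auto simp: inv_snoc)
      qed
    qed
    moreover have "cycle_count B (p \<circ> pairs_product (rs @ [x])) + cycle_count B p \<le> length (rs @ [x]) + 2 * card ?P"
      unfolding prod length_append_singleton using P(5) m card by linarith
    ultimately show ?thesis
      by (intro exI[of _ ?P] conjI)
  qed
qed

text \<open>Connectedness leaves \<open>B\<close> as the only possible block, so the partition has
  at most one member. In terms of the genus the bound reads \<open>g \<ge> 0\<close>.\<close>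

lemma connected_genus_bound:
  assumes "p permutes B" "finite B" "B \<noteq> {}" "\<forall>(r, s) \<in> set rs. r \<in> B \<and> s \<in> B \<and> r \<noteq> s"
    and "connected_on B p rs"
  shows "cycle_count B (p \<circ> pairs_product rs) + cycle_count B p \<le> length rs + 2"
proof -
  obtain P where P: "\<Union>P = B" "{} \<notin> P" "\<forall>A\<in>P. invariant p rs A"
    "cycle_count B (p \<circ> pairs_product rs) + cycle_count B p \<le> length rs + 2 * card P"
    using ex_invariant_partition[OF assms(1,2,4)] by blast
  have "A = B" if "A \<in> P" for A
    using assms(5) P that unfolding connected_on_def by (metis Sup_upper)
  then have "P \<subseteq> {B}" by auto
  then have "card P \<le> 1"
    using card_mono[of "{B}" P] by simp
  then show ?thesis
    using P(4) by linarith
qed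

section \<open>Hurwitz numbers as connected configurations\<close>

lemma sum_card_cycles:
  assumes "p permutes B" "finite B"
  shows "(\<Sum>C\<in>orbit p ` B. card C) = card B"
proof -
  have "card (\<Union>(orbit p ` B)) = (\<Sum>C\<in>orbit p ` B. card C)"
  proof (rule card_Union_disjoint)
    show "disjoint (orbit p ` B)"
      by (rule disjointI) (rule orbits_disjoint[OF assms])
    show "finite A" if "A \<in> orbit p ` B" for A
      using that permutes_orbit_subset[OF assms(1)] assms(2) by (auto dest: finite_subset)
  qed
  then show ?thesis
    using Union_orbits[OF assms] by simp
qed

lemma cycle_count_times_size:
  assumes "p permutes B" "finite B" "\<forall>x\<in>B. card (orbit p x) = a"
  shows "a * cycle_count B p = card B"
proof -
  have "(\<Sum>C\<in>orbit p ` B. card C) = (\<Sum>C\<in>orbit p ` B. a)"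
    using assms(3) by (intro sum.cong) auto
  then show ?thesis
    using sum_card_cycles[OF assms(1,2)] by (simp add: mult.commute)
qed

lemma cycle_type_replicate_iff:
  "(\<exists>k. cycle_type d p = replicate_mset k a) \<longleftrightarrow> (\<forall>x\<in>{1..d}. card (orbit p x) = a)"
proof -
  have fin: "finite (orbit p ` {1..d})"
    by simp
  have "(\<exists>k. cycle_type d p = replicate_mset k a) \<longleftrightarrow> set_mset (cycle_type d p) \<subseteq> {a}"
  proof
    assume "\<exists>k. cycle_type d p = replicate_mset k a"
    then show "set_mset (cycle_type d p) \<subseteq> {a}"
      by (auto split: if_splits)
  next
    assume "set_mset (cycle_type d p) \<subseteq> {a}"
    then show "\<exists>k. cycle_type d p = replicate_mset k a"
      by (metis set_mset_subset_singletonD)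
  qed
  also have "\<dots> \<longleftrightarrow> (\<forall>x\<in>{1..d}. card (orbit p x) = a)"
    using fin by (auto simp: cycle_type_def perm_cycles_def)
  finally show ?thesis .
qed

lemma transpose_eq_transpose_iff:
  fixes r s :: nat
  assumes "r < s" "r' < s'"
  shows "transpose r s = transpose r' s' \<longleftrightarrow> r = r' \<and> s = s'"
proof
  assume eq: "transpose r s = transpose r' s'"
  have "transpose r' s' r = s" "transpose r' s' s = r"
    by (simp_all flip: eq)
  then show "r = r' \<and> s = s'"
    using assms by (auto simp: transpose_def split: if_splits)
qed auto

lemma monotone_pairs_transpositions_inj:
  assumes "rs \<in> monotone_pairs B" "rs' \<in> monotone_pairs B"
    and "map (\<lambda>(r, s). transpose r s) rs = map (\<lambda>(r, s). transpose r s) rs'"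
  shows "rs = rs'"
proof (rule map_inj_on[OF assms(3)])
  show "inj_on (\<lambda>(r, s). transpose r s) (set rs \<union> set rs')"
  proof (rule inj_onI)
    fix x y assume xy: "x \<in> set rs \<union> set rs'" "y \<in> set rs \<union> set rs'"
      "(\<lambda>(r, s). transpose r s) x = (\<lambda>(r, s). transpose r s) y"
    obtain r s r' s' where "x = (r, s)" "y = (r', s')"
      by fastforce
    moreover from this have "r < s" "r' < s'"
      using assms(1,2) xy by (auto simp: monotone_pairs_def)
    ultimately show "x = y"
      using xy(3) transpose_eq_transpose_iff by simp
  qed
qed

text \<open>An invariant set is stable under the whole generated group, so transitivity lets it
  reach every point. Conversely, the orbit of a point under the group is nonempty and
  invariant.\<close>

lemma generates_transitive_iff:
  assumes p: "p permutes {1..d}" and rs: "rs \<in> monotone_pairs {1..d}"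
  shows "generates_transitive d (insert p (set (map (\<lambda>(r, s). transpose r s) rs))) \<longleftrightarrow>
    connected_on {1..d} p rs"
proof -
  let ?G = "sym_group d"
  let ?H = "insert p (set (map (\<lambda>(r, s). transpose r s) rs))"
  interpret group ?G by (rule sym_group_is_group)
  have tr: "transpose r s permutes {1..d}" if "(r, s) \<in> set rs" for r s
    using that rs by (intro permutes_swap_id) (auto simp: monotone_pairs_def)
  have H: "h permutes {1..d}" if "h \<in> ?H" for h
    using that p tr by auto
  then have HG: "?H \<subseteq> carrier ?G"
    unfolding sym_group_carrier[of _ d] subset_iff by blast
  have gen_comp: "h \<circ> h' \<in> generate ?G ?H" if "h \<in> ?H" "h' \<in> generate ?G ?H" for h h'
    using generate.eng[OF generate.incl[OF that(1), of ?G] that(2)] by (simp add: sym_group_mult)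
  show ?thesis
  proof
    assume trans: "generates_transitive d ?H"
    show "connected_on {1..d} p rs"
      unfolding connected_on_def
    proof (intro allI impI)
      fix A assume A: "A \<subseteq> {1..d}" "A \<noteq> {}" "invariant p rs A"
      have fA: "finite A"
        using A(1) finite_subset by blast
      have HA: "\<forall>x\<in>A. h x \<in> A" if "h \<in> ?H" for h
        using that A(3) by (auto simp: invariant_def transpose_def)
      have gA: "\<forall>x\<in>A. h x \<in> A" if "h \<in> generate ?G ?H" for h
        using that
      proof induction
        case one
        then show ?case by (simp add: sym_group_one)
      next
        case (incl h)
        then show ?case by (rule HA)
      next
        case (inv h)
        have "h permutes {1..d}" by (rule H[OF inv])
        moreover have "m_inv ?G h = Hilbert_Choice.inv h"
          using HG inv by (intro sym_group_inv_equality) auto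
        \<comment> \<open>Stability under an inverse comes from finiteness of \<open>A\<close>: a
          point outside \<open>A\<close> is not mapped into it.\<close>
        ultimately show ?case
          using permutes_stable_iff[OF _ fA HA[OF inv]] by (metis permutes_inverses(1))
      next
        case (eng h h')
        then show ?case by (simp add: sym_group_mult)
      qed
      obtain x where x: "x \<in> A"
        using A by auto
      have "y \<in> A" if "y \<in> {1..d}" for y
      proof -
        obtain h where "h \<in> generate ?G ?H" "h x = y"
          using trans x A(1) \<open>y \<in> {1..d}\<close> unfolding generates_transitive_def by blast
        then show ?thesis
          using gA x by blast
      qed
      then show "A = {1..d}"
        using A(1) by blast
    qed
  next
    assume conn: "connected_on {1..d} p rs"
    show "generates_transitive d ?H"
      unfolding generates_transitive_def
    proof (intro ballI)
      fix x y assume xy: "x \<in> {1..d}" "y \<in> {1..d}"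
      define A where "A = (\<lambda>h. h x) ` generate ?G ?H"
      have "h x \<in> {1..d}" if "h \<in> generate ?G ?H" for h
        using generate_in_carrier[OF HG that] xy(1) by (simp only: sym_group_carrier permutes_in_image)
      then have "A \<subseteq> {1..d}"
        unfolding A_def by blast
      moreover have "A \<noteq> {}"
        using generate.one[of ?G ?H] by (auto simp: A_def)
      moreover have HA: "h z \<in> A" if h: "h \<in> ?H" and z: "z \<in> A" for h z
      proof -
        obtain h' where h': "h' \<in> generate ?G ?H" "z = h' x"
          using z unfolding A_def by blast
        then have "h z = (h \<circ> h') x" by simp
        then show ?thesis
          unfolding A_def using gen_comp[OF h h'(1)] by blast
      qed
      moreover have "invariant p rs A"
      proof -
        have "r \<in> A \<longleftrightarrow> s \<in> A" if "(r, s) \<in> set rs" for r s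
        proof -
          have "transpose r s \<in> ?H" using that by force
          from HA[OF this, of r] HA[OF this, of s] show ?thesis by auto
        qed
        then show ?thesis
          using HA[of p] unfolding invariant_def by blast
      qed
      ultimately have "A = {1..d}"
        using conn unfolding connected_on_def by blast
      then have "y \<in> A"
        using xy(2) by simp
      then obtain h where "y = h x" "h \<in> generate ?G ?H"
        unfolding A_def by (rule imageE)
      then show "\<exists>h\<in>generate ?G ?H. h x = y"
        by (intro bexI[of _ h]) simp_all
    qed
  qed
qed

text \<open>The \<open>m\<close> below is \<open>k + d / a\<close>: the cycles of \<open>\<sigma>\<^sub>0\<close> have length \<open>a\<close>, so there are \<open>d / a\<close> of them.\<close>

definition euler_configs :: "nat \<Rightarrow> nat \<Rightarrow> int \<Rightarrow> ((nat \<Rightarrow> nat) \<times> (nat \<times> nat) list) set" where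
  "euler_configs a d k = {(p, rs). \<exists>m. (p, rs) \<in> connected_configs {a} {1..d} m \<and>
     int m = k + int (cycle_count {1..d} p)}"

lemma cycle_count_configs:
  assumes "a \<ge> 1" "(p, rs) \<in> configs {a} {1..d} m"
  shows "a dvd d" "cycle_count {1..d} p = d div a"
proof -
  have "a * cycle_count {1..d} p = card {1..d}"
    using assms(2) by (intro cycle_count_times_size) (auto simp: configs_def)
  then have *: "d = a * cycle_count {1..d} p" by simp
  then show "a dvd d" by (metis dvd_triv_left)
  show "cycle_count {1..d} p = d div a"
    by (subst (2) *) (use assms(1) in simp)
qed

text \<open>All members have \<open>d div a\<close> cycles in \<open>p\<close>, so \<open>k\<close>
  fixes the length \<open>m\<close>. Negative \<open>k + d / a\<close> admits no length and has to
  be kept apart, since \<open>nat\<close> truncates.\<close>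

lemma euler_configs_eq:
  assumes "a \<ge> 1"
  shows "euler_configs a d k =
    (if a dvd d \<and> k + int (d div a) \<ge> 0 then connected_configs {a} {1..d} (nat (k + int (d div a))) else {})"
proof -
  have *: "a dvd d \<and> cycle_count {1..d} p = d div a" if "(p, rs) \<in> connected_configs {a} {1..d} m" for p rs m
    using cycle_count_configs[OF assms] that by (auto simp: connected_configs_def)
  show ?thesis
  proof (intro equalityI subsetI)
    fix c assume "c \<in> euler_configs a d k"
    then obtain p rs m where c: "c = (p, rs)" "(p, rs) \<in> connected_configs {a} {1..d} m"
      "int m = k + int (cycle_count {1..d} p)"
      by (auto simp: euler_configs_def)
    have "int m = k + int (d div a)"
      using c(3) *[OF c(2)] by simp
    then have "k + int (d div a) \<ge> 0" "m = nat (k + int (d div a))"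
      by linarith+
    then show "c \<in> (if a dvd d \<and> k + int (d div a) \<ge> 0
        then connected_configs {a} {1..d} (nat (k + int (d div a))) else {})"
      using c(1,2) *[OF c(2)] by simp
  next
    fix c assume c: "c \<in> (if a dvd d \<and> k + int (d div a) \<ge> 0
      then connected_configs {a} {1..d} (nat (k + int (d div a))) else {})"
    obtain p rs where pr: "c = (p, rs)"
      by fastforce
    have "(p, rs) \<in> connected_configs {a} {1..d} (nat (k + int (d div a)))" "k + int (d div a) \<ge> 0"
      using c pr by (auto split: if_splits)
    then show "c \<in> euler_configs a d k"
      using *[of p rs] unfolding pr euler_configs_def by (auto intro!: exI[of _ "nat (k + int (d div a))"])
  qed
qed

lemma finite_euler_configs: "a \<ge> 1 \<Longrightarrow> finite (euler_configs a d k)"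
  by (simp add: euler_configs_eq finite_connected_configs)

text \<open>The cycles of the product carry no labels here and their lengths are free; both are
  restored by summing the Hurwitz counts over all length lists.\<close>

definition genus_configs :: "nat \<Rightarrow> nat \<Rightarrow> nat \<Rightarrow> nat \<Rightarrow> ((nat \<Rightarrow> nat) \<times> (nat \<times> nat) list) set" where
  "genus_configs a d g n = {(p, rs) \<in> euler_configs a d (2 * int g - 2 + int n).
     cycle_count {1..d} (p \<circ> pairs_product rs) = n}"

text \<open>Transitivity becomes connectedness, and the rational equation for \<open>m\<close>
  becomes one between integers because \<open>d / a\<close> is the number of cycles of
  \<open>p\<close>. A labelling is an enumeration of the set of cycles.\<close>

lemma hurwitz_tuples_iff:
  assumes "a \<ge> 1" "sum_list e = d" "length e = n"
  shows "(p, ts, Cs) \<in> hurwitz_tuples a g e \<longleftrightarrow>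
    (\<exists>rs. ts = map (\<lambda>(r, s). transpose r s) rs \<and> (p, rs) \<in> genus_configs a d g n \<and>
      Cs \<in> permutations_of_set (orbit (p \<circ> pairs_product rs) ` {1..d}) \<and> map card Cs = e)"
proof
  assume l: "(p, ts, Cs) \<in> hurwitz_tuples a g e"
  then obtain rs where rs: "ts = map (\<lambda>(r, s). transpose r s) rs" "rs \<in> monotone_pairs {1..d}"
    using assms by (auto simp: hurwitz_tuples_def Let_def monotone_transpositions_def monotone_pairs_def)
  have p: "p permutes {1..d}" "\<exists>k. cycle_type d p = replicate_mset k a"
    and len: "(of_nat (length ts) :: rat) = 2 * of_nat g - 2 + of_nat n + of_nat d / of_nat a"
    and Cs: "distinct Cs" "set Cs = perm_cycles d (p \<circ> pairs_product rs)" "map card Cs = e"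
    and tr: "generates_transitive d (insert p (set ts))"
    using l assms rs(1) by (auto simp: hurwitz_tuples_def Let_def pairs_product_def)
  have o: "\<forall>x\<in>{1..d}. card (orbit p x) = a"
    using p(2) cycle_type_replicate_iff by simp
  then have cfg: "(p, rs) \<in> connected_configs {a} {1..d} (length rs)"
    using p(1) rs(2) tr generates_transitive_iff[OF p(1) rs(2)]
    by (simp add: connected_configs_def configs_def rs(1))
  have "a * cycle_count {1..d} p = card {1..d}"
    using p(1) o by (intro cycle_count_times_size) auto
  then have "d = a * cycle_count {1..d} p"
    by simp
  then have "(of_nat d :: rat) / of_nat a = of_nat (cycle_count {1..d} p)"
    using assms(1) by (metis nonzero_mult_div_cancel_left not_one_le_zero of_nat_eq_0_iff of_nat_mult)
  then have "(of_nat (length rs) :: rat) = 2 * of_nat g - 2 + of_nat n + of_nat (cycle_count {1..d} p)"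
    using len rs(1) by simp
  then have "(of_int (int (length rs)) :: rat) = of_int (2 * int g - 2 + int n + int (cycle_count {1..d} p))"
    by simp
  then have "int (length rs) = 2 * int g - 2 + int n + int (cycle_count {1..d} p)"
    by (simp only: of_int_eq_iff)
  then have "(p, rs) \<in> euler_configs a d (2 * int g - 2 + int n)"
    using cfg by (auto simp: euler_configs_def)
  moreover have "cycle_count {1..d} (p \<circ> pairs_product rs) = n"
    using Cs assms(3) distinct_card[OF Cs(1)] by (metis length_map perm_cycles_def)
  ultimately have "(p, rs) \<in> genus_configs a d g n"
    by (simp add: genus_configs_def)
  then show "\<exists>rs. ts = map (\<lambda>(r, s). transpose r s) rs \<and> (p, rs) \<in> genus_configs a d g n \<and>
      Cs \<in> permutations_of_set (orbit (p \<circ> pairs_product rs) ` {1..d}) \<and> map card Cs = e"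
    using rs(1) Cs by (auto simp: permutations_of_set_def perm_cycles_def)
next
  assume "\<exists>rs. ts = map (\<lambda>(r, s). transpose r s) rs \<and> (p, rs) \<in> genus_configs a d g n \<and>
      Cs \<in> permutations_of_set (orbit (p \<circ> pairs_product rs) ` {1..d}) \<and> map card Cs = e"
  then obtain rs where rs: "ts = map (\<lambda>(r, s). transpose r s) rs" "(p, rs) \<in> genus_configs a d g n"
      "Cs \<in> permutations_of_set (orbit (p \<circ> pairs_product rs) ` {1..d})" "map card Cs = e"
    by blast
  obtain m where m: "(p, rs) \<in> connected_configs {a} {1..d} m"
    "int m = 2 * int g - 2 + int n + int (cycle_count {1..d} p)"
    using rs(2) by (auto simp: genus_configs_def euler_configs_def)
  then have cfg: "(p, rs) \<in> configs {a} {1..d} m"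
    by (simp add: connected_configs_def)
  then have p: "p permutes {1..d}" and o: "\<forall>x\<in>{1..d}. card (orbit p x) = a"
    and mp: "rs \<in> monotone_pairs {1..d}" and lm: "length rs = m"
    by (auto simp: configs_def)
  have "a * cycle_count {1..d} p = card {1..d}"
    using p o by (intro cycle_count_times_size) auto
  then have "d = a * cycle_count {1..d} p"
    by simp
  then have "(of_nat d :: rat) / of_nat a = of_nat (cycle_count {1..d} p)"
    using assms(1) by (metis nonzero_mult_div_cancel_left not_one_le_zero of_nat_eq_0_iff of_nat_mult)
  moreover have "(of_int (int m) :: rat) = of_int (2 * int g - 2 + int n + int (cycle_count {1..d} p))"
    by (simp only: m(2))
  ultimately have "(of_nat (length ts) :: rat) = 2 * of_nat g - 2 + of_nat n + of_nat d / of_nat a"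
    using lm rs(1) by simp
  moreover have "monotone_transpositions d ts"
    using mp rs(1) by (auto simp: monotone_transpositions_def monotone_pairs_def)
  moreover have "generates_transitive d (insert p (set ts))"
    using m(1) generates_transitive_iff[OF p mp] by (simp add: connected_configs_def rs(1))
  moreover have "\<exists>k. cycle_type d p = replicate_mset k a"
    using o cycle_type_replicate_iff by simp
  moreover have "distinct Cs" "set Cs = perm_cycles d (p \<circ> foldr (\<circ>) ts id)"
    using rs(1,3) by (auto simp: permutations_of_set_def perm_cycles_def pairs_product_def)
  ultimately show "(p, ts, Cs) \<in> hurwitz_tuples a g e"
    using p rs(4) assms(2,3) by (simp add: hurwitz_tuples_def Let_def)
qed

lemma configs_product_permutes:
  assumes "(p, rs) \<in> configs S B m"
  shows "(p \<circ> pairs_product rs) permutes B"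
  using assms by (intro permutes_compose pairs_product_permutes) (auto simp: configs_def monotone_pairs_def)

text \<open>A labelling determines the list of lengths, so the tuple sets for different
  \<open>e\<close> are disjoint. Their union contains each configuration with each of the
  \<open>n!\<close> enumerations of its cycles, whose lengths add up to \<open>d\<close>.\<close>

lemma card_hurwitz_tuples_sum:
  assumes "a \<ge> 1"
  shows "(\<Sum>e | length e = n \<and> sum_list e = d. card (hurwitz_tuples a g e)) =
    fact n * card (genus_configs a d g n)"
proof -
  let ?E = "{e :: nat list. length e = n \<and> sum_list e = d}"
  let ?O = "\<lambda>c. orbit (fst c \<circ> pairs_product (snd c)) ` {1..d}"
  let ?S = "SIGMA c : genus_configs a d g n. permutations_of_set (?O c)"
  let ?f = "\<lambda>(c, Cs). (fst c, map (\<lambda>(r, s). transpose r s) (snd c), Cs)"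
  have cfg: "\<exists>m. c \<in> configs {a} {1..d} m" if "c \<in> genus_configs a d g n" for c
    using that by (auto simp: genus_configs_def euler_configs_def connected_configs_def)
  have "(\<Union>e\<in>?E. hurwitz_tuples a g e) = ?f ` ?S"
  proof (intro equalityI subsetI)
    fix t assume "t \<in> (\<Union>e\<in>?E. hurwitz_tuples a g e)"
    then obtain e where e: "length e = n" "sum_list e = d" "t \<in> hurwitz_tuples a g e"
      by blast
    obtain p ts Cs where t: "t = (p, ts, Cs)"
      by (rule prod_cases3)
    obtain rs where "ts = map (\<lambda>(r, s). transpose r s) rs" "(p, rs) \<in> genus_configs a d g n"
      "Cs \<in> permutations_of_set (orbit (p \<circ> pairs_product rs) ` {1..d})"
      using e t hurwitz_tuples_iff[OF assms e(2,1)] by blast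
    then show "t \<in> ?f ` ?S"
      unfolding t by (intro image_eqI[of _ _ "((p, rs), Cs)"]) auto
  next
    fix t assume "t \<in> ?f ` ?S"
    then obtain c Cs where c: "c \<in> genus_configs a d g n" "Cs \<in> permutations_of_set (?O c)"
      "t = ?f (c, Cs)"
      by blast
    obtain p rs where pr: "c = (p, rs)"
      by fastforce
    obtain m where "(p, rs) \<in> configs {a} {1..d} m"
      using cfg c(1) pr by blast
    then have perm: "(p \<circ> pairs_product rs) permutes {1..d}"
      by (rule configs_product_permutes)
    have Cs: "distinct Cs" "set Cs = orbit (p \<circ> pairs_product rs) ` {1..d}"
      using c(2) pr by (auto simp: permutations_of_set_def)
    have "sum_list (map card Cs) = (\<Sum>C\<in>set Cs. card C)"
      using Cs(1) by (simp add: sum_list_distinct_conv_sum_set)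
    then have "sum_list (map card Cs) = d"
      using sum_card_cycles[OF perm] Cs(2) by simp
    moreover have "length (map card Cs) = n"
      using c(1) Cs distinct_card[OF Cs(1)] by (simp add: genus_configs_def pr)
    ultimately show "t \<in> (\<Union>e\<in>?E. hurwitz_tuples a g e)"
      using hurwitz_tuples_iff[OF assms, of "map card Cs" d n p _ Cs g] c pr
      by (intro UN_I[of "map card Cs"]) auto
  qed
  moreover have "card (\<Union>e\<in>?E. hurwitz_tuples a g e) = (\<Sum>e\<in>?E. card (hurwitz_tuples a g e))"
  proof (rule card_UN_disjoint)
    show "\<forall>e\<in>?E. \<forall>e'\<in>?E. e \<noteq> e' \<longrightarrow> hurwitz_tuples a g e \<inter> hurwitz_tuples a g e' = {}"
      unfolding hurwitz_tuples_def Let_def by blast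
  qed (simp_all add: finite_exponents finite_hurwitz_tuples)
  moreover have "inj_on ?f ?S"
  proof (rule inj_onI)
    fix u v assume uv: "u \<in> ?S" "v \<in> ?S" "?f u = ?f v"
    obtain p rs Cs p' rs' Cs' where u: "u = ((p, rs), Cs)" "v = ((p', rs'), Cs')"
      by (metis surj_pair)
    then have "rs \<in> monotone_pairs {1..d}" "rs' \<in> monotone_pairs {1..d}"
      using uv(1,2) cfg[of "(p, rs)"] cfg[of "(p', rs')"] by (auto simp: configs_def)
    then show "u = v"
      using uv(3) u monotone_pairs_transpositions_inj by auto
  qed
  then have "card (?f ` ?S) = card ?S"
    by (rule card_image)
  moreover have "card ?S = (\<Sum>c\<in>genus_configs a d g n. card (permutations_of_set (?O c)))"
    using finite_euler_configs[OF assms]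
    by (intro card_SigmaI) (auto simp: genus_configs_def intro: rev_finite_subset)
  moreover have "\<dots> = (\<Sum>c\<in>genus_configs a d g n. fact n)"
    by (intro sum.cong) (auto simp: genus_configs_def)
  ultimately show ?thesis
    by (simp add: mult.commute)
qed

text \<open>Cycles are nonempty, so no tuple realizes a list containing \<open>0\<close>, and both
  sides vanish there.\<close>

lemma free_energy_eq: "free_energy a g e = monotone_hurwitz a g e"
proof (cases "0 \<in> set e")
  case True
  have "hurwitz_tuples a g e = {}"
  proof (rule ccontr)
    assume "hurwitz_tuples a g e \<noteq> {}"
    then obtain p ts Cs where t: "(p, ts, Cs) \<in> hurwitz_tuples a g e"
      by (metis prod_cases3 ex_in_conv)
    let ?d = "sum_list e" and ?q = "p \<circ> foldr (\<circ>) ts id"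
    from t obtain rs where "p permutes {1..?d}" "ts = map (\<lambda>(r, s). transpose r s) rs"
      "\<forall>(r, s)\<in>set rs. r \<in> {1..?d} \<and> s \<in> {1..?d}"
      "set Cs = perm_cycles ?d ?q" and mc: "map card Cs = e"
      by (fastforce simp: hurwitz_tuples_def Let_def monotone_transpositions_def)
    then have q: "?q permutes {1..?d}" and Cs: "set Cs = orbit ?q ` {1..?d}"
      using permutes_compose[OF pairs_product_permutes[of rs "{1..?d}"]]
      by (auto simp: pairs_product_def perm_cycles_def)
    have "0 \<in> card ` set Cs"
      using True mc by (metis list.set_map)
    then obtain x where x: "x \<in> {1..?d}" "card (orbit ?q x) = 0"
      unfolding Cs by force
    have "finite (orbit ?q x)"
      using permutes_orbit_subset[OF q x(1)] by (rule finite_subset) simp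
    then show False
      using x(2) orbit_nonempty[of ?q x] by simp
  qed
  then show ?thesis
    by (simp add: free_energy_def monotone_hurwitz_def)
next
  case False
  then have "\<forall>i\<in>set e. i \<ge> 1"
    by (metis less_one not_le)
  then show ?thesis
    by (simp add: free_energy_def)
qed

lemma free_energy_diag_nth:
  assumes "a \<ge> 1"
  shows "free_energy_diag a g n $ d / fact n = of_nat (card (genus_configs a d g n)) / fact d"
proof -
  have "free_energy_diag a g n $ d = (\<Sum>e | length e = n \<and> sum_list e = d. of_nat (card (hurwitz_tuples a g e)) / fact d)"
    unfolding free_energy_diag_def fps_nth_Abs_fps
    by (intro sum.cong) (auto simp: free_energy_eq monotone_hurwitz_def)
  also have "\<dots> = of_nat (\<Sum>e | length e = n \<and> sum_list e = d. card (hurwitz_tuples a g e)) / fact d"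
    by (simp add: sum_divide_distrib)
  also have "\<dots> = fact n * of_nat (card (genus_configs a d g n)) / fact d"
    by (simp add: card_hurwitz_tuples_sum[OF assms])
  finally show ?thesis
    by simp
qed

text \<open>The product determines \<open>n\<close>. Parity makes \<open>k + 2 - n\<close> even and
  the genus bound makes it nonnegative, which yields \<open>g\<close>; \<open>d \<ge> 1\<close>
  provides \<open>n \<ge> 1\<close>.\<close>

lemma card_euler_configs:
  assumes "a \<ge> 1" "d \<ge> 1"
  shows "card (euler_configs a d k) =
    (\<Sum>(g, n) | n \<ge> 1 \<and> 2 * int g - 2 + int n = k. card (genus_configs a d g n))"
proof -
  let ?I = "{(g, n). n \<ge> 1 \<and> 2 * int g - 2 + int n = k}"
  let ?G = "\<lambda>(g, n). genus_configs a d g n"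
  have "euler_configs a d k = (\<Union>i\<in>?I. ?G i)"
  proof (intro equalityI subsetI)
    fix c assume c: "c \<in> euler_configs a d k"
    then obtain p rs m where pr: "c = (p, rs)" "(p, rs) \<in> connected_configs {a} {1..d} m"
      "int m = k + int (cycle_count {1..d} p)"
      by (auto simp: euler_configs_def)
    let ?n = "cycle_count {1..d} (p \<circ> pairs_product rs)"
    have p: "p permutes {1..d}" "length rs = m" "connected_on {1..d} p rs"
      "\<forall>(r, s)\<in>set rs. r \<in> {1..d} \<and> s \<in> {1..d} \<and> r \<noteq> s"
      using pr(2) by (auto simp: connected_configs_def configs_def monotone_pairs_def)
    have "even (?n + cycle_count {1..d} p + m)"
      using even_cycle_count_product[OF p(1) _ p(4)] p(2) by simp
    moreover have "?n + cycle_count {1..d} p \<le> m + 2"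
      using connected_genus_bound[OF p(1) _ _ p(4,3)] p(2) assms(2) by simp
    moreover have "\<exists>g. m + 2 = 2 * g + i + j" if "even (i + j + m)" "i + j \<le> m + 2" for i j :: nat
      using that by presburger
    ultimately obtain g where "m + 2 = 2 * g + ?n + cycle_count {1..d} p"
      by blast
    then have k: "2 * int g - 2 + int ?n = k"
      using pr(3) by linarith
    have "{1..d} \<noteq> {}"
      using assms(2) by simp
    then have "?n \<ge> 1"
      by (simp add: Suc_le_eq card_gt_0_iff)
    then have "(g, ?n) \<in> ?I" "c \<in> ?G (g, ?n)"
      using k c pr(1) by (auto simp: genus_configs_def)
    then show "c \<in> (\<Union>i\<in>?I. ?G i)"
      by (rule UN_I)
  qed (auto simp: genus_configs_def)
  moreover have "card (\<Union>i\<in>?I. ?G i) = (\<Sum>i\<in>?I. card (?G i))"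
  proof (rule card_UN_disjoint)
    show "finite ?I"
      by (rule finite_genus_index)
    show "\<forall>i\<in>?I. finite (?G i)"
      using finite_euler_configs[OF assms(1)]
      by (auto simp: genus_configs_def intro: rev_finite_subset)
    show "\<forall>i\<in>?I. \<forall>j\<in>?I. i \<noteq> j \<longrightarrow> ?G i \<inter> ?G j = {}"
      by (auto simp: genus_configs_def)
  qed
  ultimately show ?thesis
    by (simp add: case_prod_unfold)
qed

lemma wave_exponent_nth_nth_eq:
  assumes "a \<ge> 1" "d \<ge> 1"
  shows "fls_nth (wave_exponent a $ d) k = of_nat (card (euler_configs a d k)) / fact d"
  unfolding wave_exponent_nth_nth card_euler_configs[OF assms]
  by (simp add: free_energy_diag_nth[OF assms(1)] sum_divide_distrib case_prod_unfold)

section \<open>The wave function\<close>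

lemma connected_gf_not_dvd:
  assumes "a \<ge> 1" "\<not> a dvd d"
  shows "connected_gf {a} {1..d} = 0"
proof -
  have "connected_configs {a} {1..d} m = {}" for m
    using cycle_count_configs(1)[OF assms(1)] assms(2) by (auto simp: connected_configs_def)
  then show ?thesis
    by (simp add: connected_gf_def fps_eq_iff)
qed

text \<open>The contribution of degree \<open>d\<close> to a series in \<open>x\<close>: division by \<open>d!\<close>, and by \<open>\<hbar>\<close> to the power
  \<open>d / a\<close> since \<open>2g - 2 + n = m - d / a\<close>.\<close>

definition hbar_shift :: "nat \<Rightarrow> nat \<Rightarrow> rat fps \<Rightarrow> rat fls" where
  "hbar_shift a d f = fls_const (1 / fact d) * fls_shift (int (d div a)) (fps_to_fls f)"

lemma fls_nth_const_times: "fls_nth (fls_const c * f) k = c * fls_nth f k" for c :: "'a::semiring_1"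
  by simp

lemma hbar_shift_nth:
  "fls_nth (hbar_shift a d f) k =
    (if k + int (d div a) < 0 then 0 else f $ nat (k + int (d div a)) / fact d)"
  by (simp add: hbar_shift_def)

text \<open>If \<open>a\<close> does not divide \<open>d\<close>, the truncated quotient
  \<open>d div a\<close> does no harm, as both sides are \<open>0\<close>.\<close>

lemma wave_exponent_eq_shift:
  assumes "a \<ge> 1" "d \<ge> 1"
  shows "wave_exponent a $ d = hbar_shift a d (connected_gf {a} {1..d})"
proof (cases "a dvd d")
  case True
  then show ?thesis
    by (intro fls_eqI)
      (auto simp: wave_exponent_nth_nth_eq[OF assms] hbar_shift_nth euler_configs_eq[OF assms(1)]
        connected_gf_def)
next
  case False
  then show ?thesis
    by (intro fls_eqI)
      (auto simp: wave_exponent_nth_nth_eq[OF assms] hbar_shift_nth euler_configs_eq[OF assms(1)]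
        connected_gf_not_dvd[OF assms(1)] simp del: One_nat_def)
qed

text \<open>The candidate for the exponential of \<open>wave_exponent\<close>; the two are
  identified by a first order differential equation.\<close>

definition config_series :: "nat \<Rightarrow> rat fls fps" where
  "config_series a = Abs_fps (\<lambda>d. hbar_shift a d (config_gf {a} {1..d}))"

text \<open>The shifts add up because \<open>div\<close> is additive when \<open>a\<close> divides
  one summand. The constant exchanges \<open>i! j!\<close> for \<open>(i + j)!\<close>.\<close>

lemma hbar_shift_times:
  assumes "a dvd i"
  shows "hbar_shift a i f * hbar_shift a j g =
    fls_const (fact (i + j) / (fact i * fact j)) * hbar_shift a (i + j) (f * g)"
proof -
  have "hbar_shift a i f * hbar_shift a j g = (fls_const (1 / fact i) * fls_const (1 / fact j)) *
      (fls_shift (int (i div a)) (fps_to_fls f) * fls_shift (int (j div a)) (fps_to_fls g))"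
    by (simp only: hbar_shift_def mult_ac)
  also have "\<dots> = fls_const (1 / (fact i * fact j)) *
      fls_shift (int ((i + j) div a)) (fps_to_fls (f * g))"
    using assms unfolding fls_const_mult_const
    by (simp add: fls_times_both_shifted_simp fls_times_fps_to_fls div_plus_div_distrib_dvd_left)
  also have "\<dots> = fls_const (fact (i + j) / (fact i * fact j)) * hbar_shift a (i + j) (f * g)"
    unfolding hbar_shift_def mult.assoc[symmetric] fls_const_mult_const by simp
  finally show ?thesis .
qed

text \<open>This is \<open>config_gf_binomial_rec\<close> after division by factorials; the
  constants match by \<open>(i+1) (n+1)! / ((i+1)! (n-i)!) = (n+1) (n choose i)\<close>.\<close>

lemma config_series_deriv:
  assumes "a \<ge> 1"
  shows "fps_deriv (config_series a) = config_series a * fps_deriv (wave_exponent a)"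
proof (rule fps_ext)
  fix n
  let ?c = "\<lambda>d. connected_gf {a} {1..d}" and ?D = "\<lambda>d. config_gf {a} {1..d}"
  have summand: "of_nat (Suc i) * (wave_exponent a $ Suc i * config_series a $ (n - i)) =
      fls_const (of_nat (Suc n)) * hbar_shift a (Suc n) (of_nat (n choose i) * (?c (Suc i) * ?D (n - i)))"
    if "i \<le> n" for i
  proof (cases "a dvd Suc i")
    case True
    have "of_nat (Suc i) * (wave_exponent a $ Suc i * config_series a $ (n - i)) =
      fls_const (of_nat (Suc i)) * (fls_const (fact (Suc n) / (fact (Suc i) * fact (n - i))) *
        hbar_shift a (Suc n) (?c (Suc i) * ?D (n - i)))"
      using hbar_shift_times[OF True, of "?c (Suc i)" "n - i" "?D (n - i)"] that
      by (simp add: wave_exponent_eq_shift[OF assms] config_series_def fls_of_nat del: of_nat_Suc fact_Suc)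
    also have "\<dots> = fls_const (of_nat (Suc n)) *
        hbar_shift a (Suc n) (of_nat (n choose i) * (?c (Suc i) * ?D (n - i)))"
    proof (rule fls_eqI)
      fix k
      have "(of_nat (Suc i) * (fact (Suc n) / (fact (Suc i) * fact (n - i))) :: rat) =
          of_nat (Suc n) * of_nat (n choose i)"
        by (simp add: binomial_fact[OF that] field_simps del: of_nat_Suc)
      then show "fls_nth (fls_const (of_nat (Suc i)) * (fls_const (fact (Suc n) / (fact (Suc i) * fact (n - i))) *
        hbar_shift a (Suc n) (?c (Suc i) * ?D (n - i)))) k =
        fls_nth (fls_const (of_nat (Suc n)) *
        hbar_shift a (Suc n) (of_nat (n choose i) * (?c (Suc i) * ?D (n - i)))) k"
        unfolding mult.assoc[symmetric] fls_const_mult_const fls_nth_const_times hbar_shift_nth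
        by (simp add: fps_of_nat[symmetric] mult.assoc del: of_nat_Suc fps_of_nat fact_Suc)
    qed
    finally show ?thesis .
  next
    \<comment> \<open>The connected factor is \<open>0\<close> here, so both sides vanish and
      additivity of \<open>div\<close> is not called for.\<close>
    case False
    then show ?thesis
      by (simp add: wave_exponent_eq_shift[OF assms] connected_gf_not_dvd[OF assms] hbar_shift_def
          del: One_nat_def)
  qed
  have "(config_series a * fps_deriv (wave_exponent a)) $ n =
      (\<Sum>i\<le>n. of_nat (Suc i) * (wave_exponent a $ Suc i * config_series a $ (n - i)))"
    unfolding mult.commute[of "config_series a"] fps_mult_nth
    by (simp add: atMost_atLeast0 mult.assoc del: of_nat_Suc)
  also have "\<dots> = (\<Sum>i\<le>n. fls_const (of_nat (Suc n)) *
      hbar_shift a (Suc n) (of_nat (n choose i) * (?c (Suc i) * ?D (n - i))))"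
    by (intro sum.cong refl summand) simp
  also have "\<dots> = fls_const (of_nat (Suc n)) * hbar_shift a (Suc n) (?D (Suc n))"
  proof (rule fls_eqI)
    fix k
    have D: "?D (Suc n) = (\<Sum>i\<le>n. of_nat (n choose i) * (?c (Suc i) * ?D (n - i)))"
      using config_gf_binomial_rec[OF assms, of "Suc n"] by (simp add: lessThan_Suc_atMost)
    show "fls_nth (\<Sum>i\<le>n. fls_const (of_nat (Suc n)) *
      hbar_shift a (Suc n) (of_nat (n choose i) * (?c (Suc i) * ?D (n - i)))) k =
      fls_nth (fls_const (of_nat (Suc n)) * hbar_shift a (Suc n) (?D (Suc n))) k"
      unfolding fls_nth_sum fls_nth_const_times hbar_shift_nth D fps_sum_nth
      by (simp add: sum_distrib_left sum_divide_distrib)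
  qed
  also have "\<dots> = fps_deriv (config_series a) $ n"
    by (simp add: config_series_def fls_of_nat del: of_nat_Suc)
  finally show "fps_deriv (config_series a) $ n = (config_series a * fps_deriv (wave_exponent a)) $ n" ..
qed

text \<open>Coefficient \<open>m\<close> of \<open>f * w\<close> involves \<open>f\<close> only up
  to degree \<open>m\<close>, and characteristic zero allows division by \<open>Suc m\<close> to
  obtain the next coefficient.\<close>

lemma fps_first_order_ode_unique:
  fixes f g w :: "'a::field_char_0 fps"
  assumes "fps_deriv f = f * w" "fps_deriv g = g * w" "f $ 0 = g $ 0"
  shows "f = g"
proof -
  have "f $ n = g $ n" for n
  proof (induction n rule: less_induct)
    case (less n)
    show ?case
    proof (cases n)
      case (Suc m)
      have "fps_deriv f $ m = fps_deriv g $ m"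
        unfolding assms(1,2) fps_mult_nth using less Suc by (intro sum.cong) auto
      then show ?thesis
        using Suc by (simp del: of_nat_Suc)
    qed (use assms(3) in simp)
  qed
  then show ?thesis
    by (simp add: fps_eq_iff)
qed

lemma wave_function_eq_config_series:
  assumes "a \<ge> 1"
  shows "wave_function a = config_series a"
proof (rule fps_first_order_ode_unique)
  show "fps_deriv (wave_function a) = wave_function a * fps_deriv (wave_exponent a)"
    by (simp add: wave_function_def fps_compose_deriv[OF wave_exponent_nth_0])
  show "fps_deriv (config_series a) = config_series a * fps_deriv (wave_exponent a)"
    by (rule config_series_deriv[OF assms])
  show "wave_function a $ 0 = config_series a $ 0"
    by (simp add: wave_function_def config_series_def hbar_shift_def config_gf_empty)
qed

section \<open>Explicit coefficients of the wave function\<close>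

definition wave_coeff :: "nat \<Rightarrow> nat \<Rightarrow> rat fls" where
  "wave_coeff a k = 1 / (fact k * of_nat a ^ k * hbar ^ k) * (\<Prod>j = 1..a * k - 1. 1 / (1 - of_nat j * hbar))"

lemma one_minus_hbar_nonzero: "1 - of_nat j * hbar \<noteq> 0"
proof
  assume "1 - of_nat j * hbar = 0"
  then have "fls_nth (1 - of_nat j * hbar) 0 = 0"
    by simp
  then show False
    by (simp add: hbar_def fls_of_nat)
qed

lemma hbar_nonzero: "hbar \<noteq> 0"
  by (simp add: hbar_def)

text \<open>The factor with \<open>j = 0\<close> equals \<open>1\<close>; for \<open>n = 0\<close>
  the subtraction truncates and both products are empty.\<close>

lemma prod_shift_one:
  fixes h :: "'a::comm_ring_1"
  shows "(\<Prod>j<n. 1 - of_nat j * h) = (\<Prod>j = 1..n - 1. 1 - of_nat j * h)"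
proof (cases n)
  case (Suc m)
  have "(\<Prod>j<Suc m. 1 - of_nat j * h) = (\<Prod>j\<in>insert 0 {1..m}. 1 - of_nat j * h)"
    by (intro prod.cong) auto
  then show ?thesis
    by (simp add: Suc)
qed simp

lemma fps_to_fls_prod: "fps_to_fls (\<Prod>j\<in>A. f j) = (\<Prod>j\<in>A. fps_to_fls (f j))" for f :: "'b \<Rightarrow> 'a::comm_semiring_1 fps"
  by (induction A rule: infinite_finite_induct) (simp_all add: fls_times_fps_to_fls)

text \<open>With \<open>d = a k\<close>, the factor \<open>1 / (k! a^k)\<close> is the number of
  permutations with all cycles of length \<open>a\<close>, divided by \<open>d!\<close>. The power
  of \<open>hbar\<close> is the shift by \<open>d / a\<close>, and the product is the series of
  monotone lists.\<close>

lemma wave_function_nth: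
  assumes "a \<ge> 1"
  shows "wave_function a $ d = (if a dvd d then wave_coeff a (d div a) else 0)"
proof -
  let ?N = "card (cycle_perms {a} {1..d})"
  have N: "of_nat ?N = (if a dvd d then fact d / (of_nat a ^ (d div a) * fact (d div a)) else 0 :: rat)"
    using card_cycle_perms_singleton[OF assms, of "{1..d}"] by simp
  show ?thesis
  proof (cases "a dvd d")
    case False
    then have "?N = 0"
      using N by (metis of_nat_eq_0_iff)
    then show ?thesis
      using False by (simp add: wave_function_eq_config_series[OF assms] config_series_def config_gf_eq
          hbar_shift_def)
  next
    case True
    define k where "k = d div a"
    let ?P = "\<Prod>j = 1..d - 1. 1 - of_nat j * hbar"
    have d: "d = a * k"
      using True by (simp add: k_def)
    have "fps_to_fls (monotone_gf {1..d} * (\<Prod>j<d. 1 - of_nat j * fps_X)) = 1"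
      using monotone_gf_prod[of "{1..d}"] by simp
    then have P: "fps_to_fls (monotone_gf {1..d}) * ?P = 1"
      by (simp add: fls_times_fps_to_fls fps_to_fls_prod fps_to_fls_of_nat prod_shift_one hbar_def)
    have P0: "?P \<noteq> 0"
      using one_minus_hbar_nonzero by (simp add: prod_zero_iff del: right_minus_eq)
    have M: "fps_to_fls (monotone_gf {1..d}) = (\<Prod>j = 1..d - 1. 1 / (1 - of_nat j * hbar))"
      using P P0 by (simp add: prod_dividef field_simps)
    have eq: "fact d * hbar ^ k * wave_function a $ d = of_nat ?N * fps_to_fls (monotone_gf {1..d})"
    proof -
      have "fact d * (hbar ^ k * wave_function a $ d) =
          fact d * (fls_const (1 / fact d) * fps_to_fls (config_gf {a} {1..d}))"
        unfolding wave_function_eq_config_series[OF assms] config_series_def fps_nth_Abs_fps hbar_shift_def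
        by (simp add: hbar_def fls_X_power_times_conv_shift k_def mult.left_commute[of _ "fls_const _"]
            fls_shifted_times_simps)
      also have "\<dots> = (fact d * fls_const (1 / fact d)) * fps_to_fls (config_gf {a} {1..d})"
        by (simp only: mult.assoc)
      also have "(fact d * fls_const (1 / fact d) :: rat fls) = 1"
      proof -
        have "(fact d :: rat fls) = fls_const (fact d)"
          by (metis fls_of_nat of_nat_fact)
        then show ?thesis
          by simp
      qed
      finally show ?thesis
        by (simp add: config_gf_eq fls_times_fps_to_fls fps_to_fls_of_nat mult.assoc)
    qed
    have count: "of_nat ?N * (of_nat a ^ k * fact k) = (fact d :: rat fls)"
    proof -
      have "of_nat (?N * (a ^ k * fact k)) = (of_nat (fact d) :: rat)"
        using N True assms by (simp add: k_def)
      then have "?N * (a ^ k * fact k) = fact d"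
        by (simp only: of_nat_eq_iff)
      then have "of_nat (?N * (a ^ k * fact k)) = (of_nat (fact d) :: rat fls)"
        by (rule arg_cong)
      then show ?thesis by simp
    qed
    have "fact d * (fact k * of_nat a ^ k * hbar ^ k * wave_function a $ d) =
        (of_nat ?N * (of_nat a ^ k * fact k)) * fps_to_fls (monotone_gf {1..d})"
      using arg_cong[OF eq, of "\<lambda>z. (of_nat a ^ k * fact k) * z"] by (simp only: mult_ac)
    then have "fact d * (fact k * of_nat a ^ k * hbar ^ k * wave_function a $ d) =
        fact d * fps_to_fls (monotone_gf {1..d})"
      by (simp only: count)
    then have "fact k * of_nat a ^ k * hbar ^ k * wave_function a $ d = fps_to_fls (monotone_gf {1..d})"
      by (simp only: mult_cancel_left fact_nonzero) simp
    moreover have "fact k * of_nat a ^ k * hbar ^ k \<noteq> 0"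
      using assms hbar_nonzero by simp
    ultimately have "wave_function a $ d = wave_coeff a k"
      unfolding M wave_coeff_def d[symmetric] by (metis nonzero_mult_div_cancel_left times_divide_eq_left mult_1)
    then show ?thesis
      using True by (simp add: k_def)
  qed
qed

lemma wave_coeff_0: "wave_coeff a 0 = 1"
  by (simp add: wave_coeff_def)

text \<open>Convergence is coefficientwise: the coefficient at \<open>n\<close> is final after
  \<open>n\<close> terms, because \<open>n = a * Suc l\<close> with \<open>a \<ge> 1\<close> gives
  \<open>l < n\<close>.\<close>

lemma wave_function_sums:
  assumes "a \<ge> 1"
  shows "(\<lambda>i. fps_const (wave_coeff a (Suc i)) * fps_X ^ (a * Suc i)) sums (wave_function a - 1)"
  unfolding sums_def
proof (rule tendsto_fpsI)
  fix n
  have "(\<Sum>i<N. fps_const (wave_coeff a (Suc i)) * fps_X ^ (a * Suc i)) $ n = (wave_function a - 1) $ n"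
    if N: "N \<ge> n" for N
  proof (cases "n > 0 \<and> a dvd n")
    case True
    then obtain k where "n = a * k" by auto
    then obtain l where l: "n = a * Suc l"
      using True by (cases k) auto
    have "Suc l \<le> n"
      using l assms mult_le_mono1[of 1 a "Suc l"] by simp
    then have lN: "l < N" using N by simp
    have "(\<Sum>i<N. fps_const (wave_coeff a (Suc i)) * fps_X ^ (a * Suc i)) $ n =
        (\<Sum>i<N. if i = l then wave_coeff a (Suc l) else 0)"
      unfolding fps_sum_nth using assms l by (intro sum.cong) (auto simp: fps_X_power_nth simp del: mult_Suc_right)
    then show ?thesis
      using lN True l assms wave_function_nth[OF assms, of n] by (simp del: mult_Suc_right)
  next
    case False
    have "(\<Sum>i<N. fps_const (wave_coeff a (Suc i)) * fps_X ^ (a * Suc i)) $ n = 0"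
      unfolding fps_sum_nth using False assms
      by (intro sum.neutral) (auto simp: fps_X_power_nth simp del: mult_Suc_right)
    then show ?thesis
      using False wave_function_nth[OF assms, of n] by (auto simp: wave_coeff_0)
  qed
  then show "\<forall>\<^sub>F N in sequentially. (\<Sum>i<N. fps_const (wave_coeff a (Suc i)) * fps_X ^ (a * Suc i)) $ n =
      (wave_function a - 1) $ n"
    using eventually_ge_at_top[of n] by (rule eventually_mono[rotated])
qed

section \<open>The differential operator on coefficients\<close>

lemma x_hat_power_nth: "(x_hat ^^ m) f $ n = (if n < m then 0 else f $ (n - m))"
proof -
  have "(x_hat ^^ m) f = fps_X ^ m * f"
    by (induction m) (simp_all add: x_hat_def mult.assoc)
  then show ?thesis
    by (simp add: fps_X_power_mult_nth)
qed

lemma y_hat_nth: "y_hat f $ n = - (hbar * of_nat (Suc n) * f $ Suc n)"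
  by (simp add: y_hat_def mult.assoc)

text \<open>\<open>x_hat\<close> after \<open>y_hat\<close> is \<open>- hbar\<close> times the Euler
  operator, so each factor is diagonal on monomials; on \<open>x^n\<close> that composite has
  eigenvalue \<open>- n * hbar\<close>.\<close>

lemma curve_factor_nth: "curve_factor j f $ n = (1 + (of_nat j - of_nat n) * hbar) * f $ n"
  by (cases n) (simp_all add: curve_factor_def x_hat_def y_hat_nth algebra_simps)

lemma curve_factors_nth:
  "foldr (\<circ>) (map curve_factor js) id f $ n = (\<Prod>j\<leftarrow>js. 1 + (of_nat j - of_nat n) * hbar) * f $ n"
proof (induction js)
  case (Cons j js)
  have "foldr (\<circ>) (map curve_factor (j # js)) id f = curve_factor j (foldr (\<circ>) (map curve_factor js) id f)"
    by simp
  then show ?case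
    by (simp only: curve_factor_nth Cons.IH list.map prod_list.Cons mult.assoc)
qed simp

text \<open>Passing from \<open>k\<close> to \<open>Suc k\<close> adds the denominators
  \<open>1 - i * hbar\<close> with \<open>a * k \<le> i < a * Suc k\<close>. For
  \<open>n = a * Suc k - 1\<close> the operator supplies the factors
  \<open>1 - (n - j) * hbar\<close> with \<open>j < a\<close>, which are the same, and
  \<open>hbar * (a * Suc k)\<close> accounts for \<open>k! a^k hbar^k\<close>.\<close>

lemma wave_coeff_Suc:
  assumes "a \<ge> 1"
  shows "hbar * of_nat (a * Suc k) * (\<Prod>j<a. 1 + (of_nat j - of_nat (a * Suc k - 1)) * hbar) * wave_coeff a (Suc k) =
    wave_coeff a k"
proof -
  define F where "F j = 1 - of_nat j * hbar" for j
  have F0: "F j \<noteq> 0" for j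
    unfolding F_def by (rule one_minus_hbar_nonzero)
  \<comment> \<open>Denominators are cleared and the trivial factor \<open>j = 0\<close> is
    included, so that the product splits into segments of length \<open>a\<close>.\<close>
  have C: "wave_coeff a l * (fact l * of_nat a ^ l * hbar ^ l) * (\<Prod>j<a * l. F j) = 1" for l
  proof -
    have "(\<Prod>j<a * l. F j) = (\<Prod>j = 1..a * l - 1. F j)"
      unfolding F_def by (rule prod_shift_one)
    moreover have "(\<Prod>j = 1..a * l - 1. F j) \<noteq> 0"
      by (simp add: F0)
    moreover have "fact l * of_nat a ^ l * hbar ^ l \<noteq> 0"
      using assms hbar_nonzero by simp
    ultimately show ?thesis
      unfolding wave_coeff_def by (simp add: prod_dividef flip: F_def)
  qed
  \<comment> \<open>The factors agree in reverse order, through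
    \<open>j \<mapsto> a - 1 - j\<close>.\<close>
  have "(\<Prod>j<a. 1 + (of_nat j - of_nat (a * Suc k - 1)) * hbar) = (\<Prod>j<a. F (a * k + j))"
  proof (rule prod.reindex_bij_witness[where i = "\<lambda>j. a - 1 - j" and j = "\<lambda>j. a - 1 - j"])
    fix j assume j: "j \<in> {..<a}"
    then have "a * Suc k - 1 = (a * k + (a - 1 - j)) + j"
      by simp
    then have "(of_nat (a * Suc k - 1) :: rat fls) = of_nat (a * k + (a - 1 - j)) + of_nat j"
      by (simp only: of_nat_add)
    then show "F (a * k + (a - 1 - j)) = 1 + (of_nat j - of_nat (a * Suc k - 1)) * hbar"
      by (simp add: F_def algebra_simps)
  qed auto
  moreover have "(\<Prod>j<a * Suc k. F j) = (\<Prod>j<a * k. F j) * (\<Prod>j<a. F (a * k + j))"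
  proof -
    have "(\<Prod>j<m + n. F j) = (\<Prod>j<m. F j) * (\<Prod>j<n. F (m + j))" for m n
      by (induction n) (simp_all add: mult.assoc)
    from this[of "a * k" a] show ?thesis
      by (simp add: add.commute)
  qed
  ultimately have "hbar * of_nat (a * Suc k) * (\<Prod>j<a. 1 + (of_nat j - of_nat (a * Suc k - 1)) * hbar) *
      wave_coeff a (Suc k) * ((fact k * of_nat a ^ k * hbar ^ k) * (\<Prod>j<a * k. F j)) =
      wave_coeff a (Suc k) * (fact (Suc k) * of_nat a ^ Suc k * hbar ^ Suc k) * (\<Prod>j<a * Suc k. F j)"
    by (simp add: algebra_simps)
  also have "\<dots> = wave_coeff a k * ((fact k * of_nat a ^ k * hbar ^ k) * (\<Prod>j<a * k. F j))"
    using C[of k] C[of "Suc k"] by (simp only: mult.assoc)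
  finally show ?thesis
    using assms hbar_nonzero F0 by simp
qed

text \<open>The coefficient at \<open>n\<close> combines those of the wave function at
  \<open>n + 1\<close> and \<open>n + 1 - a\<close>. Unless \<open>a\<close> divides
  \<open>n + 1\<close> both contributions vanish; otherwise they cancel by
  \<open>wave_coeff_Suc\<close>.\<close>

lemma curve_operator_wave_function:
  assumes "a \<ge> 1"
  shows "curve_operator a (wave_function a) = 0"
proof (rule fps_ext)
  fix n
  let ?Z = "wave_function a"
  have *: "curve_operator a ?Z $ n = (if n < a - 1 then 0 else ?Z $ (n - (a - 1))) -
      hbar * of_nat (Suc n) * (\<Prod>j<a. 1 + (of_nat j - of_nat n) * hbar) * ?Z $ Suc n"
    by (simp add: curve_operator_def x_hat_power_nth curve_factors_nth y_hat_nth
        prod.distinct_set_conv_list[symmetric] atLeast0LessThan mult_ac del: of_nat_Suc)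
  show "curve_operator a ?Z $ n = 0 $ n"
  proof (cases "a dvd Suc n")
    case True
    then obtain k where "Suc n = a * k" by auto
    then obtain l where l: "Suc n = a * Suc l"
      by (cases k) auto
    then have n: "n = a * Suc l - 1" "\<not> n < a - 1" "n - (a - 1) = a * l"
      using assms by auto
    have "?Z $ Suc n = wave_coeff a (Suc l)" "?Z $ (n - (a - 1)) = wave_coeff a l"
      unfolding wave_function_nth[OF assms] n(3) l using assms by (simp_all del: mult_Suc_right)
    then show ?thesis
      using * n(2) wave_coeff_Suc[OF assms, of l] by (simp add: l[symmetric] n(1)[symmetric] del: mult_Suc_right of_nat_Suc)
  next
    case False
    then have "\<not> a dvd (n - (a - 1))" if "\<not> n < a - 1"
    proof -
      have "Suc n = (n - (a - 1)) + a"
        using that assms by simp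
      then show ?thesis
        using False by (metis dvd_add_right_iff dvd_refl add.commute)
    qed
    then show ?thesis
      using * False by (simp add: wave_function_nth[OF assms])
  qed
qed

theorem theorem3:
  fixes a :: nat
  assumes "a \<ge> 1"
  shows "((\<lambda>i. let k = Suc i in
            fps_const (1 / (fact k * of_nat a ^ k * hbar ^ k) *
              (\<Prod>j = 1..a * k - 1. 1 / (1 - of_nat j * hbar))) * fps_X ^ (a * k))
         sums (wave_function a - 1)) \<and>
         curve_operator a (wave_function a) = 0"
  using wave_function_sums[OF assms] curve_operator_wave_function[OF assms]
  by (simp add: wave_coeff_def Let_def del: mult_Suc_right fact_Suc power_Suc)

end
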